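(* For any $T>0$ there exist iid sub-Gaussian random variables $\eta_t$, $t\ge1$, with $\mathbb E(\eta_t)=0$, $\mathrm{Var}(\eta_t)=1$ and $\|\eta_t\|_{\psi_2}<\infty$, such that, with $\widetilde S_n$ the interpolated partial sum process of $\eta_t$ and $\rho_2(h)=\sqrt{h\log(e/h)}$: (i) there exist $C>0$ and, for any $t>C$, some $\kappa(t)>1$ and $K(t)>0$ such that $P\left(\frac{|\widetilde S_n(u)-\widetilde S_n(v)|}{\rho_2(|u-v|)}>t\right)\le K(t)|u-v|^{\kappa(t)}$ for all $n$ and all $u\neq v\in[0,1]$; there exist $p>0$ and $\widetilde K>0$ with $\rho_2(zh)\le\widetilde Kz^p\rho_2(h)$ for all $h,z\in[0,1]$; and the finite-dimensional marginals of $\widetilde S_n$ converge weakly to those of a standard Brownian motion; (ii) nevertheless, $\liminf_{n\to\infty}P\left(|\widetilde S_n|_{\rho_2}\ge T\right)=1$.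
   Context: $\widetilde S_n(u)=\frac1{\sqrt n}\sum_{t=1}^{\lfloor un\rfloor}\eta_t+\frac{un-\lfloor un\rfloor}{\sqrt n}\eta_{\lfloor un\rfloor+1}$, $u\in[0,1]$. For $f\in C[0,1]$, $|f|_{\rho_2}=\sup_{u\ne v\in[0,1]}|f(u)-f(v)|/\rho_2(|u-v|)$, with $\rho_2(0)=0$. The sub-Gaussian norm is $\|X\|_{\psi_2}=\inf\{c>0:\mathbb E\exp(X^2/c^2)\le2\}$. *)

theory Defs
  imports "HOL-Probability.Probability"
begin

text \<open>The innovations are indexed by \<open>t \<ge> 1\<close>; \<open>\<eta> 0\<close> is never used. At \<open>u = 1\<close> the weight
  of the extra innovation \<open>\<eta> (n + 1)\<close> is zero.\<close>

definition interp_partial_sum ::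
  "(nat \<Rightarrow> 'a \<Rightarrow> real) \<Rightarrow> nat \<Rightarrow> real \<Rightarrow> 'a \<Rightarrow> real" where
  "interp_partial_sum \<eta> n u \<omega> =
     1 / sqrt (real n) * (\<Sum>t = 1..nat \<lfloor>u * real n\<rfloor>. \<eta> t \<omega>)
     + (u * real n - of_int \<lfloor>u * real n\<rfloor>) / sqrt (real n)
         * \<eta> (nat \<lfloor>u * real n\<rfloor> + 1) \<omega>"

definition rho2 :: "real \<Rightarrow> real" where
  "rho2 h = (if h = 0 then 0 else sqrt (h * ln (exp 1 / h)))"

text \<open>The supremum is taken in \<^typ>\<open>ereal\<close>, as it is infinite for some continuous \<open>f\<close>.\<close>

definition modulus_seminorm :: "(real \<Rightarrow> real) \<Rightarrow> (real \<Rightarrow> real) \<Rightarrow> ereal" where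
  "modulus_seminorm \<rho> f =
     (SUP (u, v) \<in> {(u, v). u \<in> {0..1} \<and> v \<in> {0..1} \<and> u \<noteq> v}.
        ereal (\<bar>f u - f v\<bar> / \<rho> \<bar>u - v\<bar>))"

text \<open>The expectation is a nonnegative (possibly infinite) integral, and the infimum of the
  empty set is \<open>\<infinity>\<close>, so that finiteness of the norm means sub-Gaussianity.\<close>

definition psi2_norm :: "'a measure \<Rightarrow> ('a \<Rightarrow> real) \<Rightarrow> ennreal" where
  "psi2_norm M X =
     (INF c \<in> {c::real. c > 0 \<and> (\<integral>\<^sup>+ \<omega>. ennreal (exp ((X \<omega>)\<^sup>2 / c\<^sup>2)) \<partial>M) \<le> 2}. ennreal c)"

text \<open>A standard Brownian motion with time set \<open>[0,1]\<close>; \<open>W t\<close> is unconstrained for other \<open>t\<close>.\<close>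

definition standard_brownian_motion :: "'a measure \<Rightarrow> (real \<Rightarrow> 'a \<Rightarrow> real) \<Rightarrow> bool" where
  "standard_brownian_motion N W \<longleftrightarrow>
     prob_space N \<and>
     (\<forall>t\<in>{0..1}. W t \<in> borel_measurable N) \<and>
     (AE \<omega> in N. W 0 \<omega> = 0) \<and>
     (\<forall>(k::nat) t. t ` {..k} \<subseteq> {0..1} \<and> mono_on {..k} t \<longrightarrow>
        prob_space.indep_vars N (\<lambda>_. borel) (\<lambda>i \<omega>. W (t (Suc i)) \<omega> - W (t i) \<omega>) {..<k}) \<and>
     (\<forall>s t. 0 \<le> s \<and> s < t \<and> t \<le> 1 \<longrightarrow>
        distributed N lborel (\<lambda>\<omega>. W t \<omega> - W s \<omega>)
          (\<lambda>x. ennreal (normal_density 0 (sqrt (t - s)) x))) \<and>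
     (AE \<omega> in N. continuous_on {0..1} (\<lambda>t. W t \<omega>))"

definition marginal ::
  "'a measure \<Rightarrow> ('i \<Rightarrow> 'a \<Rightarrow> real) \<Rightarrow> 'i set \<Rightarrow> ('i \<Rightarrow> real) measure" where
  "marginal M X J = distr M (\<Pi>\<^sub>M j\<in>J. borel) (\<lambda>\<omega>. \<lambda>j\<in>J. X j \<omega>)"

text \<open>Weak convergence of measures on the Euclidean space of real vectors indexed by the
  finite set \<open>J\<close>, tested against bounded continuous functions.\<close>

definition weak_conv_vec ::
  "'i set \<Rightarrow> (nat \<Rightarrow> ('i \<Rightarrow> real) measure) \<Rightarrow> ('i \<Rightarrow> real) measure \<Rightarrow> bool" where
  "weak_conv_vec J \<mu> \<nu> \<longleftrightarrow>
     (\<forall>f. continuous_map (product_topology (\<lambda>_. euclideanreal) J) euclideanreal f \<and>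
          bounded (f ` (\<Pi>\<^sub>E j\<in>J. UNIV)) \<longrightarrow>
        (\<lambda>n. \<integral>x. f x \<partial>\<mu> n) \<longlonglongrightarrow> (\<integral>x. f x \<partial>\<nu>))"

end

theory Submission
  imports Defs "HOL-Real_Asymp.Real_Asymp"
begin

text \<open>
  The innovations are drawn from a centred mixture of two normal laws with total variance 1, one of
  which has variance \<open>r\<^sup>2 = 2 T\<^sup>2 + 2\<close> and small weight. Their moment generating function is
  dominated by that of \<open>N(0, r\<^sup>2)\<close>, so an increment of the interpolation over a distance \<open>h\<close>, being
  a weighted sum of innovations whose squared weights add up to at most \<open>h\<close>, satisfies the
  Chernoff bound \<open>2 exp (- x\<^sup>2 / (2 r\<^sup>2 h))\<close>; at \<open>x = t rho2 h\<close> this is at most \<open>2 h\<close> to the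
  power \<open>t\<^sup>2 / (2 r\<^sup>2)\<close>.

  On the other hand, a single step of the interpolation gives \<open>\<bar>\<eta> k\<bar> / sqrt (1 + ln n)\<close> as a
  lower bound for the seminorm, and \<open>r\<close> is so large that \<open>n P(\<bar>\<eta> 1\<bar> \<ge> T sqrt (1 + ln n))\<close>
  grows at least like \<open>sqrt n\<close>. Hence with probability tending to 1 some \<open>k \<le> n\<close> exceeds this threshold.
\<close>

section \<open>Tails of the increments\<close>

text \<open>Standard normal innovations do not suffice for large T: the largest of n of them is
  about sqrt (2 ln n), so a single step of the interpolation contributes only about sqrt 2. The
  limit of the marginals depends on the innovations only through their variance, while the size of
  one step is governed by their tail constant. A wide component of small weight makes the latter as
  large as desired while the variance stays 1.

  Normal components keep the moment generating function and the characteristic function explicit, so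
  that the tail bound and the central limit theorem both become computations with convex
  combinations of exponentials.

  The tail bound and the lower bound do not conflict: the exponent
  \<open>t\<^sup>2 / (2 * r\<^sup>2)\<close> exceeds 1 only for t > sqrt 2 * r, and this threshold
  is larger than T.

  The marginals are tested against arbitrary bounded continuous functions, and the fractional weight
  of the last innovation depends on n without converging. Hence the joint limit theorem below admits
  test functions that vary with n.\<close>

definition interp_weight :: "nat \<Rightarrow> real \<Rightarrow> nat \<Rightarrow> real" where
  "interp_weight n u t = max 0 (min 1 (u * real n - (real t - 1)))"

lemma interp_weight_mono: "v \<le> u \<Longrightarrow> interp_weight n v t \<le> interp_weight n u t"
  unfolding interp_weight_def by (intro max.mono min.mono diff_right_mono mult_right_mono) auto

text \<open>\<open>interp_weight n u t\<close> is the length of the part of [t - 1, t] below u n: it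
  is 1 up to m = floor (u n), the fractional part at m + 1, and 0 beyond. One index set for all u
  lets increments be subtracted termwise; it reaches n + 1 because m may equal n.\<close>

lemma interp_partial_sum_eq_weighted_sum:
  assumes "u \<in> {0..1}"
  shows "interp_partial_sum \<eta> n u \<omega> =
    (\<Sum>t = 1..n + 1. interp_weight n u t / sqrt (real n) * \<eta> t \<omega>)"
proof -
  define m where "m = nat \<lfloor>u * real n\<rfloor>"
  have m: "of_int \<lfloor>u * real n\<rfloor> = real m" "real m \<le> u * real n" "u * real n < real m + 1"
    using assms by (auto simp: m_def)
  have "u * real n \<le> real n" using assms by (simp add: mult_left_le_one_le)
  with m(2) have "m \<le> n" by linarith
  then have split: "{1..n + 1} = {1..m} \<union> insert (m + 1) {m + 2..n + 1}" by auto
  have "(\<Sum>t = 1..n + 1. interp_weight n u t / sqrt (real n) * \<eta> t \<omega>)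
    = (\<Sum>t = 1..m. interp_weight n u t / sqrt (real n) * \<eta> t \<omega>)
      + interp_weight n u (m + 1) / sqrt (real n) * \<eta> (m + 1) \<omega>
      + (\<Sum>t = m + 2..n + 1. interp_weight n u t / sqrt (real n) * \<eta> t \<omega>)"
    unfolding split by (subst sum.union_disjoint) auto
  also have "(\<Sum>t = 1..m. interp_weight n u t / sqrt (real n) * \<eta> t \<omega>)
      = (\<Sum>t = 1..m. 1 / sqrt (real n) * \<eta> t \<omega>)"
    using m by (intro sum.cong) (auto simp: interp_weight_def)
  also have "(\<Sum>t = m + 2..n + 1. interp_weight n u t / sqrt (real n) * \<eta> t \<omega>) = 0"
    using m by (intro sum.neutral) (auto simp: interp_weight_def)
  also have "interp_weight n u (m + 1) = u * real n - real m"
    using m by (simp add: interp_weight_def)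
  finally show ?thesis
    by (simp add: interp_partial_sum_def m(1) sum_divide_distrib flip: m_def)
qed

text \<open>Innovations identically 1 turn the weighted-sum formula into the total weight, since
  their interpolated sums are linear in u.\<close>

lemma sum_interp_weight:
  assumes "u \<in> {0..1}"
  shows "(\<Sum>t = 1..n + 1. interp_weight n u t) = u * real n"
proof (cases "n = 0")
  case False
  have "(\<Sum>t = 1..n + 1. interp_weight n u t) / sqrt (real n)
      = interp_partial_sum (\<lambda>_ _. 1) n u ()"
    using interp_partial_sum_eq_weighted_sum[OF assms, of "\<lambda>_ _. 1" n "()"]
    by (simp add: sum_divide_distrib del: sum.cl_ivl_Suc)
  also have "\<dots> = u * real n / sqrt (real n)"
    using assms by (simp add: interp_partial_sum_def flip: add_divide_distrib)
  finally show ?thesis using False by simp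
qed (simp add: interp_weight_def)

text \<open>For v \<le> u every weight difference lies in [0, 1], so its square is at most the
  difference itself, and the differences add up to (u - v) n. No case distinction is made on whether
  u and v share a cell of the grid.\<close>

lemma sum_sq_interp_weight_diff:
  assumes "u \<in> {0..1}" "v \<in> {0..1}" "n \<ge> 1"
  shows "(\<Sum>t = 1..n + 1. ((interp_weight n u t - interp_weight n v t) / sqrt (real n))\<^sup>2) \<le> \<bar>u - v\<bar>"
proof -
  have *: "(\<Sum>t = 1..n + 1. (interp_weight n u t - interp_weight n v t)\<^sup>2) \<le> (u - v) * real n"
    if "v \<le> u" "u \<in> {0..1}" "v \<in> {0..1}" for u v
  proof -
    have "(\<Sum>t = 1..n + 1. (interp_weight n u t - interp_weight n v t)\<^sup>2)
        \<le> (\<Sum>t = 1..n + 1. interp_weight n u t - interp_weight n v t)"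
    proof (rule sum_mono)
      fix t
      have "0 \<le> interp_weight n u t - interp_weight n v t"
        "interp_weight n u t - interp_weight n v t \<le> 1"
        using interp_weight_mono[OF that(1)] by (auto simp: interp_weight_def)
      then show "(interp_weight n u t - interp_weight n v t)\<^sup>2
          \<le> interp_weight n u t - interp_weight n v t"
        by (simp add: power2_eq_square mult_left_le)
    qed
    also have "\<dots> = (u - v) * real n"
      unfolding sum_subtractf sum_interp_weight[OF that(2)] sum_interp_weight[OF that(3)]
      by (simp add: left_diff_distrib)
    finally show ?thesis .
  qed
  have "(\<Sum>t = 1..n + 1. (interp_weight n u t - interp_weight n v t)\<^sup>2) \<le> \<bar>u - v\<bar> * real n"
    using *[of v u] *[of u v] assms by (cases "v \<le> u") (auto simp: power2_commute)
  then have "(\<Sum>t = 1..n + 1. (interp_weight n u t - interp_weight n v t)\<^sup>2) / real n \<le> \<bar>u - v\<bar>"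
    using assms by (simp add: field_simps)
  then show ?thesis
    by (simp add: power_divide flip: sum_divide_distrib del: sum.cl_ivl_Suc)
qed

section \<open>The modulus \<open>rho2\<close>\<close>

lemma one_minus_ln_pos: "0 < h \<Longrightarrow> h \<le> 1 \<Longrightarrow> 0 < 1 - ln (h::real)"
  using ln_le_zero_iff[of h] by linarith

lemma rho2_sq: "0 < h \<Longrightarrow> h \<le> 1 \<Longrightarrow> (rho2 h)\<^sup>2 = h * (1 - ln h)"
  using one_minus_ln_pos[of h] by (simp add: rho2_def ln_div)

lemma rho2_pos: "0 < h \<Longrightarrow> h \<le> 1 \<Longrightarrow> 0 < rho2 h"
  using one_minus_ln_pos[of h] by (simp add: rho2_def ln_div)

text \<open>Both logarithms are nonpositive, so 1 - ln z - ln h is at most the product of 1 - ln z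
  and 1 - ln h. Half of the power of z is spent on the bound sqrt z (1 - ln z) \<le> 2; the other
  half leaves the exponent 1/4 after the square root.\<close>

lemma rho2_scaling:
  assumes "h \<in> {0..1}" "z \<in> {0..1}"
  shows "rho2 (z * h) \<le> sqrt 2 * z powr (1/4) * rho2 h"
proof (cases "h = 0 \<or> z = 0")
  case False
  then have h: "0 < h" "h \<le> 1" and z: "0 < z" "z \<le> 1" and zh: "0 < z * h" "z * h \<le> 1"
    using assms by (auto simp: mult_le_one)
  have "- ln z = 2 * ln (1 / sqrt z)" using z by (simp add: ln_div ln_sqrt)
  also have "\<dots> \<le> 2 * (1 / sqrt z - 1)"
    using z ln_le_minus_one[of "1 / sqrt z"] by simp
  finally have "sqrt z * (1 - ln z) \<le> sqrt z * (2 / sqrt z - 1)"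
    using z by (intro mult_left_mono) auto
  also have "\<dots> \<le> 2" using z by (simp add: field_simps)
  finally have 1: "sqrt z * (1 - ln z) \<le> 2" .
  have 2: "(z powr (1/4))\<^sup>2 = sqrt z"
    using z by (simp add: power2_eq_square powr_half_sqrt flip: powr_add)
  have "(rho2 (z * h))\<^sup>2 = z * h * (1 - ln z - ln h)"
    using zh h z by (simp add: rho2_sq ln_mult)
  also have "\<dots> \<le> z * h * ((1 - ln z) * (1 - ln h))"
    using h z by (intro mult_left_mono) (auto simp: algebra_simps mult_nonpos_nonpos)
  also have "\<dots> = sqrt z * (1 - ln z) * (sqrt z * (h * (1 - ln h)))"
    using z by simp
  also have "\<dots> \<le> 2 * (sqrt z * (h * (1 - ln h)))"
    using h z 1 one_minus_ln_pos[of h] by (intro mult_right_mono) auto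
  also have "\<dots> = (sqrt 2 * z powr (1/4) * rho2 h)\<^sup>2"
    using z h by (simp add: power_mult_distrib rho2_sq 2)
  finally show ?thesis
    by (rule power2_le_imp_le) (use rho2_pos[OF h] in simp)
qed (auto simp: rho2_def)

section \<open>Chernoff bounds for weighted sums of independent variables\<close>

lemma (in prob_space) subgaussian_sum_tail_ge:
  fixes X :: "'i \<Rightarrow> 'a \<Rightarrow> real"
  assumes "finite I" "indep_vars (\<lambda>_. borel) X I"
    and mgf: "\<And>i l. i \<in> I \<Longrightarrow> (\<integral>\<^sup>+\<omega>. ennreal (exp (l * X i \<omega>)) \<partial>M) \<le> ennreal (exp (l\<^sup>2 * b / 2))"
    and V: "(\<Sum>i\<in>I. (a i)\<^sup>2) \<le> V" "V > 0" "b > 0" and "x \<ge> 0"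
  shows "prob {\<omega>\<in>space M. x \<le> (\<Sum>i\<in>I. a i * X i \<omega>)} \<le> exp (- x\<^sup>2 / (2 * b * V))"
proof -
  have [measurable]: "X i \<in> borel_measurable M" if "i \<in> I" for i
    using assms(2) that by (auto simp: indep_vars_def)
  \<comment> \<open>The minimiser of the exponent \<open>- l * x + l\<^sup>2 * b / 2 * V\<close>
    reached below.\<close>
  define l where "l = x / (b * V)"
  have "l \<ge> 0" using V \<open>x \<ge> 0\<close> by (simp add: l_def)
  let ?S = "\<lambda>\<omega>. \<Sum>i\<in>I. a i * X i \<omega>"
  have "emeasure M {\<omega>\<in>space M. x \<le> ?S \<omega>}
      \<le> emeasure M {\<omega>\<in>space M. 1 \<le> ennreal (exp (- l * x)) * ennreal (exp (l * ?S \<omega>))}"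
    using \<open>l \<ge> 0\<close> by (intro emeasure_mono)
      (auto simp: mult_left_mono simp flip: ennreal_mult' exp_add ennreal_1)
  also have "\<dots> \<le> ennreal (exp (- l * x)) * (\<integral>\<^sup>+\<omega>. ennreal (exp (l * ?S \<omega>)) * indicator (space M) \<omega> \<partial>M)"
    by (intro nn_integral_Markov_inequality) auto
  also have "(\<integral>\<^sup>+\<omega>. ennreal (exp (l * ?S \<omega>)) * indicator (space M) \<omega> \<partial>M)
      = (\<integral>\<^sup>+\<omega>. (\<Prod>i\<in>I. ennreal (exp (l * a i * X i \<omega>))) \<partial>M)"
    using \<open>finite I\<close>
    by (intro nn_integral_cong) (simp add: sum_distrib_left exp_sum prod_ennreal mult.assoc)
  also have "\<dots> = (\<Prod>i\<in>I. \<integral>\<^sup>+\<omega>. ennreal (exp (l * a i * X i \<omega>)) \<partial>M)"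
    by (intro indep_vars_nn_integral assms indep_vars_compose2[OF assms(2)]) auto
  also have "\<dots> \<le> (\<Prod>i\<in>I. ennreal (exp ((l * a i)\<^sup>2 * b / 2)))"
    by (intro prod_mono_ennreal mgf)
  also have "\<dots> = ennreal (exp (l\<^sup>2 * b / 2 * (\<Sum>i\<in>I. (a i)\<^sup>2)))"
    using \<open>finite I\<close>
    by (simp add: prod_ennreal exp_sum[symmetric] sum_distrib_left power_mult_distrib algebra_simps)
  also have "\<dots> \<le> ennreal (exp (l\<^sup>2 * b / 2 * V))"
    using V by (intro ennreal_leI) (auto intro!: mult_left_mono)
  finally have "emeasure M {\<omega>\<in>space M. x \<le> ?S \<omega>} \<le> ennreal (exp (- l * x + l\<^sup>2 * b / 2 * V))"
    by (subst exp_add, subst ennreal_mult') (simp_all add: mult_left_mono)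
  also have "- l * x + l\<^sup>2 * b / 2 * V = - x\<^sup>2 / (2 * b * V)"
    using V by (simp add: l_def field_simps power2_eq_square)
  finally show ?thesis by (simp add: emeasure_eq_measure)
qed

lemma (in prob_space) subgaussian_sum_tail_abs:
  fixes X :: "'i \<Rightarrow> 'a \<Rightarrow> real"
  assumes "finite I" "indep_vars (\<lambda>_. borel) X I"
    and mgf: "\<And>i l. i \<in> I \<Longrightarrow> (\<integral>\<^sup>+\<omega>. ennreal (exp (l * X i \<omega>)) \<partial>M) \<le> ennreal (exp (l\<^sup>2 * b / 2))"
    and V: "(\<Sum>i\<in>I. (a i)\<^sup>2) \<le> V" "V > 0" "b > 0" and "x \<ge> 0"
  shows "prob {\<omega>\<in>space M. x < \<bar>\<Sum>i\<in>I. a i * X i \<omega>\<bar>} \<le> 2 * exp (- x\<^sup>2 / (2 * b * V))"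
proof -
  have [measurable]: "X i \<in> borel_measurable M" if "i \<in> I" for i
    using assms(2) that by (auto simp: indep_vars_def)
  have "prob {\<omega>\<in>space M. x < \<bar>\<Sum>i\<in>I. a i * X i \<omega>\<bar>}
      \<le> prob ({\<omega>\<in>space M. x \<le> (\<Sum>i\<in>I. a i * X i \<omega>)} \<union> {\<omega>\<in>space M. x \<le> (\<Sum>i\<in>I. - a i * X i \<omega>)})"
    by (intro finite_measure_mono) (auto simp: sum_negf)
  also have "\<dots> \<le> prob {\<omega>\<in>space M. x \<le> (\<Sum>i\<in>I. a i * X i \<omega>)} + prob {\<omega>\<in>space M. x \<le> (\<Sum>i\<in>I. - a i * X i \<omega>)}"
    by (intro measure_Un_le) auto
  also have "\<dots> \<le> exp (- x\<^sup>2 / (2 * b * V)) + exp (- x\<^sup>2 / (2 * b * V))"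
    using V by (intro add_mono subgaussian_sum_tail_ge assms) auto
  finally show ?thesis by simp
qed

lemma (in prob_space) interp_partial_sum_increment_tail:
  fixes \<eta> :: "nat \<Rightarrow> 'a \<Rightarrow> real"
  assumes indep: "indep_vars (\<lambda>_. borel) \<eta> {1..}"
    and mgf: "\<And>i l. i \<ge> 1 \<Longrightarrow> (\<integral>\<^sup>+\<omega>. ennreal (exp (l * \<eta> i \<omega>)) \<partial>M) \<le> ennreal (exp (l\<^sup>2 * b / 2))"
    and "b > 0" "t > 0" "n \<ge> 1" and uv: "u \<in> {0..1}" "v \<in> {0..1}" "u \<noteq> v"
  shows "prob {\<omega> \<in> space M.
      \<bar>interp_partial_sum \<eta> n u \<omega> - interp_partial_sum \<eta> n v \<omega>\<bar> / rho2 \<bar>u - v\<bar> > t}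
    \<le> 2 * \<bar>u - v\<bar> powr (t\<^sup>2 / (2 * b))"
proof -
  define h where "h = \<bar>u - v\<bar>"
  have h: "0 < h" "h \<le> 1" using uv by (auto simp: h_def)
  define a where "a i = (interp_weight n u i - interp_weight n v i) / sqrt (real n)" for i
  have diff: "interp_partial_sum \<eta> n u \<omega> - interp_partial_sum \<eta> n v \<omega>
      = (\<Sum>i = 1..n + 1. a i * \<eta> i \<omega>)" for \<omega>
    using uv by (simp add: interp_partial_sum_eq_weighted_sum a_def sum_subtractf[symmetric]
        diff_divide_distrib left_diff_distrib del: sum.cl_ivl_Suc)
  have "prob {\<omega> \<in> space M.
      \<bar>interp_partial_sum \<eta> n u \<omega> - interp_partial_sum \<eta> n v \<omega>\<bar> / rho2 h > t}
    = prob {\<omega> \<in> space M. t * rho2 h < \<bar>\<Sum>i = 1..n + 1. a i * \<eta> i \<omega>\<bar>}"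
    using rho2_pos[OF h] by (simp add: diff pos_less_divide_eq del: sum.cl_ivl_Suc)
  also have "\<dots> \<le> 2 * exp (- (t * rho2 h)\<^sup>2 / (2 * b * h))"
  proof (rule subgaussian_sum_tail_abs)
    show "indep_vars (\<lambda>_. borel) \<eta> {1..n + 1}"
      by (rule indep_vars_subset[OF indep]) auto
    show "(\<Sum>i = 1..n + 1. (a i)\<^sup>2) \<le> h"
      unfolding a_def h_def by (rule sum_sq_interp_weight_diff) fact+
  qed (use h \<open>b > 0\<close> \<open>t > 0\<close> rho2_pos[OF h] mgf in auto)
  \<comment> \<open>The factor h in the square of \<open>rho2 h\<close> cancels against the variance
    bound V = h, and what remains is a multiple of 1 - ln h. The logarithm becomes a power of h, and
    the constant factor left over is at most 1.\<close>
  also have "- (t * rho2 h)\<^sup>2 / (2 * b * h) = t\<^sup>2 / (2 * b) * ln h - t\<^sup>2 / (2 * b)"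
    using h \<open>b > 0\<close> by (simp add: power_mult_distrib rho2_sq field_simps)
  also have "exp \<dots> \<le> h powr (t\<^sup>2 / (2 * b))"
    using h \<open>b > 0\<close> by (simp add: powr_def)
  finally show ?thesis by (simp add: h_def)
qed

section \<open>Mixtures of two centred normal laws\<close>

definition normal_mixture :: "real \<Rightarrow> real \<Rightarrow> real \<Rightarrow> real measure" where
  "normal_mixture p s r = density lborel
     (\<lambda>x. ennreal ((1 - p) * normal_density 0 s x + p * normal_density 0 r x))"

lemma sets_normal_mixture [simp, measurable_cong]: "sets (normal_mixture p s r) = sets borel"
  and space_normal_mixture [simp]: "space (normal_mixture p s r) = UNIV"
  by (simp_all add: normal_mixture_def)

lemma nn_integral_normal_mixture:
  assumes "0 \<le> p" "p \<le> 1" and [measurable]: "g \<in> borel_measurable borel"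
  shows "(\<integral>\<^sup>+x. g x \<partial>normal_mixture p s r) =
    ennreal (1 - p) * (\<integral>\<^sup>+x. ennreal (normal_density 0 s x) * g x \<partial>lborel)
    + ennreal p * (\<integral>\<^sup>+x. ennreal (normal_density 0 r x) * g x \<partial>lborel)"
  using assms by (simp add: normal_mixture_def nn_integral_density ennreal_plus ennreal_mult
      distrib_right nn_integral_add nn_integral_cmult mult.assoc)

text \<open>Vector values let this serve both the real moments and the complex characteristic
  function.\<close>

lemma has_bochner_integral_normal_mixture:
  fixes g :: "real \<Rightarrow> 'b::{banach, second_countable_topology}"
  assumes "0 \<le> p" "p \<le> 1" and [measurable]: "g \<in> borel_measurable borel"
    and "has_bochner_integral lborel (\<lambda>x. normal_density 0 s x *\<^sub>R g x) a"
    and "has_bochner_integral lborel (\<lambda>x. normal_density 0 r x *\<^sub>R g x) b"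
  shows "has_bochner_integral (normal_mixture p s r) g ((1 - p) *\<^sub>R a + p *\<^sub>R b)"
proof -
  have "has_bochner_integral lborel
      (\<lambda>x. (1 - p) *\<^sub>R (normal_density 0 s x *\<^sub>R g x) + p *\<^sub>R (normal_density 0 r x *\<^sub>R g x))
      ((1 - p) *\<^sub>R a + p *\<^sub>R b)"
    using assms by (intro has_bochner_integral_add has_bochner_integral_scaleR_right) auto
  then show ?thesis
    unfolding normal_mixture_def using assms
    by (intro has_bochner_integral_density) (auto simp: scaleR_add_left)
qed

lemma nn_integral_normal_density: "0 < s \<Longrightarrow> (\<integral>\<^sup>+x. ennreal (normal_density m s x) \<partial>lborel) = 1"
  by (subst nn_integral_eq_integral) auto

lemma prob_space_normal_mixture:
  assumes "0 \<le> p" "p \<le> 1" "0 < s" "0 < r"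
  shows "prob_space (normal_mixture p s r)"
proof (rule prob_spaceI)
  have "emeasure (normal_mixture p s r) UNIV = (\<integral>\<^sup>+x. 1 \<partial>normal_mixture p s r)"
    by simp
  also have "\<dots> = 1"
    using assms by (subst nn_integral_normal_mixture)
      (auto simp: nn_integral_normal_density simp flip: ennreal_plus)
  finally show "emeasure (normal_mixture p s r) (space (normal_mixture p s r)) = 1" by simp
qed

text \<open>Completing the square: tilting N(0, s^2) by exp (l x) gives a constant times the density
  of N(l s^2, s^2).\<close>

lemma nn_integral_normal_exp:
  assumes "0 < s"
  shows "(\<integral>\<^sup>+x. ennreal (normal_density 0 s x) * ennreal (exp (l * x)) \<partial>lborel)
    = ennreal (exp (l\<^sup>2 * s\<^sup>2 / 2))"
proof -
  have "normal_density 0 s x * exp (l * x) = exp (l\<^sup>2 * s\<^sup>2 / 2) * normal_density (l * s\<^sup>2) s x" for x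
  proof -
    have "- x\<^sup>2 / (2 * s\<^sup>2) + l * x = l\<^sup>2 * s\<^sup>2 / 2 - (x - l * s\<^sup>2)\<^sup>2 / (2 * s\<^sup>2)"
      using assms by (simp add: field_simps power2_eq_square)
    then show ?thesis
      by (simp add: normal_density_def field_simps flip: exp_add exp_diff)
  qed
  then have "(\<integral>\<^sup>+x. ennreal (normal_density 0 s x) * ennreal (exp (l * x)) \<partial>lborel)
    = (\<integral>\<^sup>+x. ennreal (exp (l\<^sup>2 * s\<^sup>2 / 2)) * ennreal (normal_density (l * s\<^sup>2) s x) \<partial>lborel)"
    by (simp flip: ennreal_mult')
  also have "\<dots> = ennreal (exp (l\<^sup>2 * s\<^sup>2 / 2))"
    using assms by (simp add: nn_integral_cmult nn_integral_normal_density)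
  finally show ?thesis .
qed

text \<open>Already for r = s the factor cancels only half of the Gaussian exponent. What remains is
  sqrt 2 times the density of N(0, 2 s^2), and sqrt 2 \<le> 2.\<close>

lemma nn_integral_normal_exp_square:
  assumes "0 < s" "s \<le> r"
  shows "(\<integral>\<^sup>+x. ennreal (normal_density 0 s x) * ennreal (exp (x\<^sup>2 / (2 * r)\<^sup>2)) \<partial>lborel) \<le> 2"
proof -
  have "normal_density 0 s x * exp (x\<^sup>2 / (2 * r)\<^sup>2) \<le> sqrt 2 * normal_density 0 (sqrt 2 * s) x" for x
  proof -
    have "x\<^sup>2 / (2 * r)\<^sup>2 \<le> x\<^sup>2 / (2 * s)\<^sup>2"
      using assms by (intro divide_left_mono power_mono) auto
    also have "- x\<^sup>2 / (2 * s\<^sup>2) + x\<^sup>2 / (2 * s)\<^sup>2 = - x\<^sup>2 / (2 * (sqrt 2 * s)\<^sup>2)"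
      using assms by (simp add: power_mult_distrib field_simps)
    then have "x\<^sup>2 / (2 * s)\<^sup>2 = - x\<^sup>2 / (2 * (sqrt 2 * s)\<^sup>2) + x\<^sup>2 / (2 * s\<^sup>2)"
      by linarith
    finally have "exp (- x\<^sup>2 / (2 * s\<^sup>2)) * exp (x\<^sup>2 / (2 * r)\<^sup>2) \<le> exp (- x\<^sup>2 / (2 * (sqrt 2 * s)\<^sup>2))"
      by (simp flip: exp_add)
    then have "normal_density 0 s x * exp (x\<^sup>2 / (2 * r)\<^sup>2)
        \<le> 1 / sqrt (2 * pi * s\<^sup>2) * exp (- x\<^sup>2 / (2 * (sqrt 2 * s)\<^sup>2))"
      unfolding normal_density_def mult.assoc diff_zero by (rule mult_left_mono) simp
    also have "\<dots> = sqrt 2 * normal_density 0 (sqrt 2 * s) x"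
      using assms by (simp add: normal_density_def real_sqrt_mult power_mult_distrib field_simps)
    finally show ?thesis .
  qed
  then have "(\<integral>\<^sup>+x. ennreal (normal_density 0 s x) * ennreal (exp (x\<^sup>2 / (2 * r)\<^sup>2)) \<partial>lborel)
    \<le> (\<integral>\<^sup>+x. ennreal (sqrt 2) * ennreal (normal_density 0 (sqrt 2 * s) x) \<partial>lborel)"
    by (intro nn_integral_mono) (simp flip: ennreal_mult')
  also have "\<dots> = ennreal (sqrt 2)"
    using assms by (simp add: nn_integral_cmult nn_integral_normal_density)
  also have "\<dots> \<le> ennreal 2"
    by (intro ennreal_leI real_le_lsqrt) auto
  finally show ?thesis by simp
qed

lemma distr_std_normal_scale:
  assumes "0 < s"
  shows "distr std_normal_distribution borel (\<lambda>x. s * x) = density lborel (normal_density 0 s)"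
proof -
  interpret S: real_distribution std_normal_distribution by (rule real_dist_normal_dist)
  have "distributed std_normal_distribution lborel (\<lambda>x. x) std_normal_density"
    by (simp add: distributed_def distr_id2)
  from S.normal_density_affine[OF this, of s 0] assms show ?thesis
    by (simp add: distributed_def cong: distr_cong)
qed

lemma has_bochner_integral_normal_iexp:
  assumes "0 < s"
  shows "has_bochner_integral lborel (\<lambda>x. normal_density 0 s x *\<^sub>R iexp (l * x))
    (complex_of_real (exp (- (l * s)\<^sup>2 / 2)))"
proof -
  have "char (density lborel (normal_density 0 s)) l = char std_normal_distribution (l * s)"
    unfolding char_def by (subst distr_std_normal_scale[OF assms, symmetric], subst integral_distr) (simp_all add: mult_ac)
  then have "(CLINT x|density lborel (normal_density 0 s). iexp (l * x))
      = complex_of_real (exp (- (l * s)\<^sup>2 / 2))"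
    by (simp add: char_std_normal_distribution char_def)
  moreover have "integrable (density lborel (normal_density 0 s)) (\<lambda>x. iexp (l * x))"
  proof -
    interpret N: prob_space "density lborel (normal_density 0 s)"
      using assms by (rule prob_space_normal_density)
    show ?thesis by (rule N.integrable_const_bound[where B=1]) auto
  qed
  ultimately show ?thesis
    by (simp add: has_bochner_integral_iff integrable_density integral_density)
qed

lemma char_normal_mixture:
  assumes "0 \<le> p" "p \<le> 1" "0 < s" "0 < r"
  shows "char (normal_mixture p s r) l =
    complex_of_real ((1 - p) * exp (- (l * s)\<^sup>2 / 2) + p * exp (- (l * r)\<^sup>2 / 2))"
  unfolding char_def using assms
  by (subst has_bochner_integral_integral_eq[OF has_bochner_integral_normal_mixture[OF _ _ _
        has_bochner_integral_normal_iexp has_bochner_integral_normal_iexp]])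
    (auto simp: scaleR_conv_of_real)

lemma normal_mixture_mgf:
  assumes "0 \<le> p" "p \<le> 1" "0 < s" "s \<le> r"
  shows "(\<integral>\<^sup>+x. ennreal (exp (l * x)) \<partial>normal_mixture p s r) \<le> ennreal (exp (l\<^sup>2 * r\<^sup>2 / 2))"
proof -
  have "s\<^sup>2 \<le> r\<^sup>2" using assms by (intro power_mono) auto
  then have "exp (l\<^sup>2 * s\<^sup>2 / 2) \<le> exp (l\<^sup>2 * r\<^sup>2 / 2)" by (simp add: mult_left_mono)
  then have "(1 - p) * exp (l\<^sup>2 * s\<^sup>2 / 2) + p * exp (l\<^sup>2 * r\<^sup>2 / 2)
      \<le> (1 - p) * exp (l\<^sup>2 * r\<^sup>2 / 2) + p * exp (l\<^sup>2 * r\<^sup>2 / 2)"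
    using assms by (intro add_right_mono mult_left_mono) auto
  also have "\<dots> = exp (l\<^sup>2 * r\<^sup>2 / 2)" by (simp add: algebra_simps)
  finally have "ennreal ((1 - p) * exp (l\<^sup>2 * s\<^sup>2 / 2) + p * exp (l\<^sup>2 * r\<^sup>2 / 2))
      \<le> ennreal (exp (l\<^sup>2 * r\<^sup>2 / 2))"
    by (rule ennreal_leI)
  then show ?thesis
    using assms
    by (simp add: nn_integral_normal_mixture nn_integral_normal_exp ennreal_plus ennreal_mult)
qed

lemma normal_mixture_exp_square:
  assumes "0 \<le> p" "p \<le> 1" "0 < s" "s \<le> r"
  shows "(\<integral>\<^sup>+x. ennreal (exp (x\<^sup>2 / (2 * r)\<^sup>2)) \<partial>normal_mixture p s r) \<le> 2"
proof -
  have "(\<integral>\<^sup>+x. ennreal (exp (x\<^sup>2 / (2 * r)\<^sup>2)) \<partial>normal_mixture p s r)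
      = ennreal (1 - p)
          * (\<integral>\<^sup>+x. ennreal (normal_density 0 s x) * ennreal (exp (x\<^sup>2 / (2 * r)\<^sup>2)) \<partial>lborel)
        + ennreal p
          * (\<integral>\<^sup>+x. ennreal (normal_density 0 r x) * ennreal (exp (x\<^sup>2 / (2 * r)\<^sup>2)) \<partial>lborel)"
    using assms by (intro nn_integral_normal_mixture) auto
  also have "\<dots> \<le> ennreal (1 - p) * 2 + ennreal p * 2"
    using assms by (intro add_mono mult_left_mono nn_integral_normal_exp_square) auto
  also have "\<dots> = 2"
    using assms by (simp flip: ennreal_plus distrib_right)
  finally show ?thesis .
qed

lemma has_bochner_integral_normal_mixture_id:
  assumes "0 \<le> p" "p \<le> 1" "0 < s" "0 < r"
  shows "has_bochner_integral (normal_mixture p s r) (\<lambda>x. x) 0"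
  using has_bochner_integral_normal_mixture[of p "\<lambda>x. x" s 0 r 0] assms
    normal_moment_nz_1[of s 0] normal_moment_nz_1[of r 0] by simp

lemma has_bochner_integral_normal_mixture_square:
  assumes "0 \<le> p" "p \<le> 1" "0 < s" "0 < r"
  shows "has_bochner_integral (normal_mixture p s r) (\<lambda>x. x\<^sup>2) ((1 - p) * s\<^sup>2 + p * r\<^sup>2)"
  using has_bochner_integral_normal_mixture[of p "\<lambda>x. x\<^sup>2" s "s\<^sup>2" r "r\<^sup>2"] assms
    normal_moment_even[of s 0 1] normal_moment_even[of r 0 1] by simp

text \<open>Only the component of standard deviation r on [x, x + 1] is kept; its density decreases
  there, so it is at least the value at the right end.\<close>

lemma normal_mixture_tail_lower_bound:
  assumes "0 \<le> p" "p \<le> 1" "0 < s" "0 < r" "0 \<le> x"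
  shows "p * normal_density 0 r (x + 1) \<le> measure (normal_mixture p s r) {y. x \<le> \<bar>y\<bar>}"
proof -
  interpret prob_space "normal_mixture p s r" using assms by (intro prob_space_normal_mixture)
  have "ennreal (normal_density 0 r (x + 1)) =
      (\<integral>\<^sup>+y. ennreal (normal_density 0 r (x + 1)) * indicator {x..x + 1} y \<partial>lborel)"
    by (simp add: nn_integral_cmult)
  also have "\<dots> \<le> (\<integral>\<^sup>+y. ennreal (normal_density 0 r y) * indicator {y. x \<le> \<bar>y\<bar>} y \<partial>lborel)"
    using assms by (intro nn_integral_mono)
      (auto simp: indicator_def normal_density_def divide_right_mono intro!: ennreal_leI power_mono)
  finally have "ennreal p * ennreal (normal_density 0 r (x + 1))
      \<le> (\<integral>\<^sup>+y. indicator {y. x \<le> \<bar>y\<bar>} y \<partial>normal_mixture p s r)"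
    using assms by (subst nn_integral_normal_mixture) (auto intro!: add_increasing mult_left_mono)
  then show ?thesis
    using assms by (simp add: emeasure_eq_measure flip: ennreal_mult')
qed

section \<open>Finite-dimensional marginals\<close>

text \<open>An image law rather than a density, so that v = 0 gives the point mass at 0. That case
  occurs as the limit law of blocks with at most one innovation.\<close>

definition centered_normal :: "real \<Rightarrow> real measure" where
  "centered_normal v = distr std_normal_distribution borel (\<lambda>x. sqrt v * x)"

lemma real_distribution_centered_normal: "real_distribution (centered_normal v)"
proof -
  interpret S: real_distribution std_normal_distribution by (rule real_dist_normal_dist)
  show ?thesis by (simp add: centered_normal_def)
qed

lemma char_centered_normal:
  assumes "0 \<le> v"
  shows "char (centered_normal v) l = complex_of_real (exp (- l\<^sup>2 * v / 2))"
proof -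
  have "char (centered_normal v) l = char std_normal_distribution (l * sqrt v)"
    unfolding char_def centered_normal_def by (subst integral_distr) (simp_all add: mult_ac)
  then show ?thesis
    using assms by (simp add: char_std_normal_distribution power_mult_distrib)
qed

lemma distributed_normal_density_imp_centered_normal:
  assumes "distributed M lborel X (\<lambda>x. ennreal (normal_density 0 (sqrt v) x))" "0 < v"
  shows "distr M borel X = centered_normal v"
  using assms by (simp add: distributed_def centered_normal_def distr_std_normal_scale cong: distr_cong)

lemma AE_centered_normal_0: "AE x in centered_normal 0. x = 0"
  unfolding centered_normal_def by (subst AE_distr_iff) auto

text \<open>The power equals the exponential of m n / n times the difference quotient of ln f at 0
  with step 1/n, where f is the convex combination as a function of 1/n and f 0 = 1. The quotient
  tends to the derivative of ln f at 0.\<close>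

lemma mixture_exp_power_tendsto:
  fixes a b p d l :: real and m :: "nat \<Rightarrow> nat"
  assumes p: "0 \<le> p" "p \<le> 1" and m: "(\<lambda>n. real (m n) / real n) \<longlonglongrightarrow> d"
  shows "(\<lambda>n. ((1 - p) * exp (- a / real n) + p * exp (- b / real n)) ^ m n)
    \<longlonglongrightarrow> exp (- ((1 - p) * a + p * b) * d)"
proof -
  define f where "f h = (1 - p) * exp (- a * h) + p * exp (- b * h)" for h
  have f_pos: "f h > 0" for h
  proof (cases "p = 0")
    case False
    then show ?thesis using p by (auto simp: f_def intro!: add_nonneg_pos)
  qed (simp add: f_def)
  have f0: "f 0 = 1" by (simp add: f_def)
  have "((\<lambda>h. ln (f h)) has_real_derivative - ((1 - p) * a + p * b)) (at 0)"
    unfolding f_def by (auto intro!: derivative_eq_intros simp: algebra_simps)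
  then have "((\<lambda>h. ln (f h) / h) \<longlongrightarrow> - ((1 - p) * a + p * b)) (at 0)"
    by (simp add: DERIV_def f0)
  moreover have "filterlim (\<lambda>n. inverse (real n)) (at 0) sequentially"
    unfolding filterlim_at using eventually_gt_at_top[of 0]
    by (auto intro!: tendsto_eq_intros LIMSEQ_inverse_real_of_nat simp: tendsto_inverse_0_at_top
        filterlim_real_sequentially elim!: eventually_mono)
  ultimately have "(\<lambda>n. ln (f (inverse (real n))) / inverse (real n)) \<longlonglongrightarrow> - ((1 - p) * a + p * b)"
    by (rule filterlim_compose)
  from tendsto_exp[OF tendsto_mult[OF this m]]
  have "(\<lambda>n. exp (ln (f (inverse (real n))) / inverse (real n) * (real (m n) / real n)))
    \<longlonglongrightarrow> exp (- ((1 - p) * a + p * b) * d)" .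
  then show ?thesis
  proof (rule Lim_transform_eventually)
    show "\<forall>\<^sub>F n in sequentially.
        exp (ln (f (inverse (real n))) / inverse (real n) * (real (m n) / real n))
        = ((1 - p) * exp (- a / real n) + p * exp (- b / real n)) ^ m n"
      using eventually_gt_at_top[of 0]
    proof eventually_elim
      case (elim n)
      then have "exp (ln (f (inverse (real n))) / inverse (real n) * (real (m n) / real n))
          = exp (ln (f (inverse (real n)))) ^ m n"
        by (simp add: exp_of_nat_mult mult.commute flip: exp_of_nat_mult)
      also have "\<dots> = f (inverse (real n)) ^ m n"
        by (simp add: f_pos)
      finally show ?case by (simp add: f_def divide_inverse)
    qed
  qed
qed

text \<open>Central limit theorem over index sets that move with n. The innovations are independent
  with a common law, so the characteristic function depends on the set only through its size and is
  an exact power of a convex combination of exponentials; its limit involves the mixture only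
  through its variance, which is 1. The relative size may tend to 0.\<close>

lemma (in prob_space) block_sum_weak_conv:
  fixes \<eta> :: "nat \<Rightarrow> 'a \<Rightarrow> real"
  assumes indep: "indep_vars (\<lambda>_. borel) \<eta> {1..}"
    and law: "\<And>t. t \<ge> 1 \<Longrightarrow> distr M borel (\<eta> t) = normal_mixture p s r"
    and psr: "0 \<le> p" "p \<le> 1" "0 < s" "0 < r" "(1 - p) * s\<^sup>2 + p * r\<^sup>2 = 1"
    and A: "\<And>n. finite (A n)" "\<And>n. A n \<subseteq> {1..}"
    and d: "(\<lambda>n. real (card (A n)) / real n) \<longlonglongrightarrow> d"
  shows "weak_conv_m (\<lambda>n. distr M borel (\<lambda>\<omega>. (\<Sum>t\<in>A n. \<eta> t \<omega>) / sqrt (real n))) (centered_normal d)"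
proof (rule levy_continuity)
  have rv [measurable]: "\<eta> t \<in> borel_measurable M" if "t \<ge> 1" for t
    using indep that by (auto simp: indep_vars_def)
  have [measurable]: "\<eta> t \<in> borel_measurable M" if "t \<in> A n" for t n
    using rv that A(2) by fastforce
  show "real_distribution (distr M borel (\<lambda>\<omega>. (\<Sum>t\<in>A n. \<eta> t \<omega>) / sqrt (real n)))" for n
    by (rule real_distribution_distr) measurable
  show "real_distribution (centered_normal d)"
    by (rule real_distribution_centered_normal)
  have "d \<ge> 0" by (rule LIMSEQ_le_const[OF d]) auto
  fix l
  have char: "char (distr M borel (\<lambda>\<omega>. (\<Sum>t\<in>A n. \<eta> t \<omega>) / sqrt (real n))) l
    = complex_of_real (((1 - p) * exp (- (l\<^sup>2 * s\<^sup>2 / 2) / real n)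
        + p * exp (- (l\<^sup>2 * r\<^sup>2 / 2) / real n)) ^ card (A n))" for n
  proof -
    have "char (distr M borel (\<lambda>\<omega>. (\<Sum>t\<in>A n. \<eta> t \<omega>) / sqrt (real n))) l
      = char (distr M borel (\<lambda>\<omega>. \<Sum>t\<in>A n. \<eta> t \<omega> / sqrt (real n))) l"
      by (simp add: sum_divide_distrib)
    also have "\<dots> = (\<Prod>t\<in>A n. char (distr M borel (\<lambda>\<omega>. \<eta> t \<omega> / sqrt (real n))) l)"
      by (rule char_distr_sum, rule indep_vars_compose2[OF indep_vars_subset[OF indep A(2)]]) auto
    also have "\<dots> = (\<Prod>t\<in>A n. char (normal_mixture p s r) (l / sqrt (real n)))"
    proof (rule prod.cong)
      fix t assume "t \<in> A n"
      then have "t \<ge> 1" using A(2) by fastforce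
      then have "char (normal_mixture p s r) (l / sqrt (real n))
          = char (distr M borel (\<eta> t)) (l / sqrt (real n))" by (simp add: law)
      also have "\<dots> = char (distr M borel (\<lambda>\<omega>. \<eta> t \<omega> / sqrt (real n))) l"
        using \<open>t \<ge> 1\<close> by (simp add: char_def integral_distr)
      finally show "char (distr M borel (\<lambda>\<omega>. \<eta> t \<omega> / sqrt (real n))) l
          = char (normal_mixture p s r) (l / sqrt (real n))" ..
    qed simp
    finally show ?thesis
      using psr by (simp add: char_normal_mixture power_mult_distrib power_divide mult_ac)
  qed
  have "(\<lambda>n. ((1 - p) * exp (- (l\<^sup>2 * s\<^sup>2 / 2) / real n)
        + p * exp (- (l\<^sup>2 * r\<^sup>2 / 2) / real n)) ^ card (A n))
    \<longlonglongrightarrow> exp (- ((1 - p) * (l\<^sup>2 * s\<^sup>2 / 2) + p * (l\<^sup>2 * r\<^sup>2 / 2)) * d)"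
    by (rule mixture_exp_power_tendsto[OF psr(1,2) d])
  also have "(1 - p) * (l\<^sup>2 * s\<^sup>2 / 2) + p * (l\<^sup>2 * r\<^sup>2 / 2)
      = l\<^sup>2 / 2 * ((1 - p) * s\<^sup>2 + p * r\<^sup>2)"
    by (simp add: field_simps)
  finally show "(\<lambda>n. char (distr M borel (\<lambda>\<omega>. (\<Sum>t\<in>A n. \<eta> t \<omega>) / sqrt (real n))) l)
      \<longlonglongrightarrow> char (centered_normal d) l"
    unfolding char char_centered_normal[OF \<open>d \<ge> 0\<close>] psr(5)
    by (intro tendsto_of_real) simp
qed

section \<open>Joint convergence of independent coordinates\<close>

lemma indep_vars_PiM_coordinates:
  assumes M: "\<And>i. i \<in> I \<Longrightarrow> prob_space (M i)" and "I \<noteq> {}"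
  shows "prob_space.indep_vars (PiM I M) M (\<lambda>i \<omega>. \<omega> i) I"
proof -
  interpret prob_space "PiM I M" by (rule prob_space_PiM[OF M])
  have "distr (PiM I M) (PiM I M) (\<lambda>x. \<lambda>i\<in>I. x i) = distr (PiM I M) (PiM I M) (\<lambda>x. x)"
    by (intro distr_cong) (auto simp: space_PiM PiE_def extensional_def fun_eq_iff)
  also have "\<dots> = PiM I (\<lambda>i. distr (PiM I M) (M i) (\<lambda>\<omega>. \<omega> i))"
    by (subst distr_id2) (auto intro!: PiM_cong distr_PiM_component[symmetric] M)
  finally show ?thesis
    by (subst indep_vars_iff_distr_eq_PiM'[OF \<open>I \<noteq> {}\<close>]) auto
qed

text \<open>Skorohod representations of the coordinates, put on independent copies, turn joint
  convergence in law into pointwise convergence, so that dominated convergence applies.\<close>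

lemma (in prob_space) indep_expectation_tendsto:
  fixes X :: "nat \<Rightarrow> 'i \<Rightarrow> 'a \<Rightarrow> real" and \<nu> :: "'i \<Rightarrow> real measure"
    and g :: "nat \<Rightarrow> ('i \<Rightarrow> real) \<Rightarrow> real"
  assumes I: "finite I" "I \<noteq> {}"
    and rv: "\<And>n i. i \<in> I \<Longrightarrow> random_variable borel (X n i)"
    and indep: "\<forall>\<^sub>F n in sequentially. indep_vars (\<lambda>_. borel) (X n) I"
    and \<nu>: "\<And>i. i \<in> I \<Longrightarrow> real_distribution (\<nu> i)"
    and conv: "\<And>i. i \<in> I \<Longrightarrow> weak_conv_m (\<lambda>n. distr M borel (X n i)) (\<nu> i)"
    and g [measurable]: "\<And>n. g n \<in> borel_measurable (PiM I (\<lambda>_. borel))"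
    and G [measurable]: "G \<in> borel_measurable (PiM I (\<lambda>_. borel))"
    and bound: "\<And>n y. \<bar>g n y\<bar> \<le> B"
    and lim: "AE y in PiM I \<nu>. \<forall>Y. (\<forall>i\<in>I. (\<lambda>n. Y n i) \<longlonglongrightarrow> y i) \<longrightarrow> (\<lambda>n. g n (Y n)) \<longlonglongrightarrow> G y"
  shows "(\<lambda>n. expectation (\<lambda>\<omega>. g n (\<lambda>i\<in>I. X n i \<omega>))) \<longlonglongrightarrow> (\<integral>y. G y \<partial>PiM I \<nu>)"
proof -
  note [measurable] = rv
  \<comment> \<open>\<open>Q i\<close> bundles the conclusion of Skorohod's theorem for the
    coordinate i, so that one choice provides the spaces and variables of all coordinates at
    once.\<close>
  define Q where "Q i = (\<lambda>(\<Omega> :: real measure, Z, Z'). prob_space \<Omega> \<and> (\<forall>n. Z n \<in> measurable \<Omega> borel) \<and>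
      (\<forall>n. distr \<Omega> borel (Z n) = distr M borel (X n i)) \<and> Z' \<in> measurable \<Omega> lborel \<and>
      distr \<Omega> borel Z' = \<nu> i \<and> (\<forall>x\<in>space \<Omega>. (\<lambda>n. Z n x) \<longlonglongrightarrow> Z' x))" for i
  have "\<exists>T. Q i T" if "i \<in> I" for i
    using Skorohod[of "\<lambda>n. distr M borel (X n i)" "\<nu> i"] that \<nu> conv rv
    unfolding Q_def split_paired_Ex by simp
  then obtain F where F: "\<And>i. i \<in> I \<Longrightarrow> Q i (F i)"
    using bchoice[of I Q] by auto
  define \<Omega> Z Z' where "\<Omega> i = fst (F i)" and "Z i = fst (snd (F i))" and "Z' i = snd (snd (F i))" for i
  have \<Omega>: "prob_space (\<Omega> i)"
    and Z: "Z i n \<in> measurable (\<Omega> i) borel"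
    and Z_law: "distr (\<Omega> i) borel (Z i n) = distr M borel (X n i)"
    and Z': "Z' i \<in> measurable (\<Omega> i) lborel"
    and Z'_law: "distr (\<Omega> i) borel (Z' i) = \<nu> i"
    and Z_lim: "x \<in> space (\<Omega> i) \<Longrightarrow> (\<lambda>n. Z i n x) \<longlonglongrightarrow> Z' i x" if "i \<in> I" for i n x
    using F[OF that] by (auto simp: Q_def \<Omega>_def Z_def Z'_def split_beta)
  have [measurable]: "Z i n \<in> borel_measurable (\<Omega> i)" "Z' i \<in> borel_measurable (\<Omega> i)"
    if "i \<in> I" for i n
    using Z Z' that by auto
  interpret P: prob_space "PiM I \<Omega>" by (rule prob_space_PiM[OF \<Omega>])
  \<comment> \<open>On the product of the Skorohod spaces the copies are independent, so their joint
    law is determined by the coordinate laws. This serves both the approximating and the limit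
    variables.\<close>
  have joint: "distr (PiM I \<Omega>) (PiM I (\<lambda>_. borel)) (\<lambda>x. \<lambda>i\<in>I. V i (x i))
      = PiM I (\<lambda>i. distr (\<Omega> i) borel (V i))"
    if V: "\<And>i. i \<in> I \<Longrightarrow> V i \<in> borel_measurable (\<Omega> i)" for V :: "'i \<Rightarrow> real \<Rightarrow> real"
  proof -
    have "P.indep_vars (\<lambda>_. borel) (\<lambda>i x. V i (x i)) I"
      using V by (intro P.indep_vars_compose2[OF indep_vars_PiM_coordinates[OF \<Omega> I(2)]])
    then have "distr (PiM I \<Omega>) (PiM I (\<lambda>_. borel)) (\<lambda>x. \<lambda>i\<in>I. V i (x i))
        = PiM I (\<lambda>i. distr (PiM I \<Omega>) borel (\<lambda>x. V i (x i)))"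
      using V I(2) by (subst (asm) P.indep_vars_iff_distr_eq_PiM')
        (auto intro: measurable_compose[OF measurable_component_singleton])
    also have "\<dots> = PiM I (\<lambda>i. distr (\<Omega> i) borel (V i))"
    proof (rule PiM_cong)
      fix i assume i: "i \<in> I"
      have "distr (PiM I \<Omega>) borel (\<lambda>x. V i (x i)) = distr (distr (PiM I \<Omega>) (\<Omega> i) (\<lambda>x. x i)) borel (V i)"
        using V i by (subst distr_distr) (auto simp: comp_def)
      then show "distr (PiM I \<Omega>) borel (\<lambda>x. V i (x i)) = distr (\<Omega> i) borel (V i)"
        by (simp only: distr_PiM_component[of I \<Omega>, OF \<Omega> i])
    qed simp
    finally show ?thesis .
  qed
  have joint_lim: "distr (PiM I \<Omega>) (PiM I (\<lambda>_. borel)) (\<lambda>x. \<lambda>i\<in>I. Z' i (x i)) = PiM I \<nu>"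
    by (subst joint) (auto intro!: PiM_cong simp: Z'_law)
  have "(\<lambda>n. \<integral>x. g n (\<lambda>i\<in>I. Z i n (x i)) \<partial>PiM I \<Omega>) \<longlonglongrightarrow> (\<integral>x. G (\<lambda>i\<in>I. Z' i (x i)) \<partial>PiM I \<Omega>)"
  proof (rule integral_dominated_convergence[where w = "\<lambda>_. B"])
    have "AE x in PiM I \<Omega>. \<forall>Y. (\<forall>i\<in>I. (\<lambda>n. Y n i) \<longlonglongrightarrow> (\<lambda>i\<in>I. Z' i (x i)) i)
        \<longrightarrow> (\<lambda>n. g n (Y n)) \<longlonglongrightarrow> G (\<lambda>i\<in>I. Z' i (x i))"
      by (rule AE_distrD[OF _ lim[folded joint_lim]]) measurable
    then show "AE x in PiM I \<Omega>. (\<lambda>n. g n (\<lambda>i\<in>I. Z i n (x i))) \<longlonglongrightarrow> G (\<lambda>i\<in>I. Z' i (x i))"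
      using AE_space
    proof eventually_elim
      case (elim x)
      then show ?case
        using Z_lim by (intro elim(1)[rule_format]) (auto simp: space_PiM PiE_iff)
    qed
  qed (use bound in auto)
  also have "(\<integral>x. G (\<lambda>i\<in>I. Z' i (x i)) \<partial>PiM I \<Omega>) = (\<integral>y. G y \<partial>PiM I \<nu>)"
    unfolding joint_lim[symmetric] by (subst integral_distr) auto
  finally show ?thesis
  proof (rule Lim_transform_eventually)
    show "\<forall>\<^sub>F n in sequentially. (\<integral>x. g n (\<lambda>i\<in>I. Z i n (x i)) \<partial>PiM I \<Omega>)
        = expectation (\<lambda>\<omega>. g n (\<lambda>i\<in>I. X n i \<omega>))"
      using indep
    proof eventually_elim
      case (elim n)
      \<comment> \<open>The copies live on another space than \<open>X n\<close>, but independence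
        gives both vectors the same product law, and the expectation depends on that law
        only.\<close>
      have "(\<integral>x. g n (\<lambda>i\<in>I. Z i n (x i)) \<partial>PiM I \<Omega>)
          = (\<integral>y. g n y \<partial>distr (PiM I \<Omega>) (PiM I (\<lambda>_. borel)) (\<lambda>x. \<lambda>i\<in>I. Z i n (x i)))"
        by (subst integral_distr) auto
      also have "distr (PiM I \<Omega>) (PiM I (\<lambda>_. borel)) (\<lambda>x. \<lambda>i\<in>I. Z i n (x i))
          = PiM I (\<lambda>i. distr M borel (X n i))"
        by (subst joint) (auto intro!: PiM_cong simp: Z_law)
      also have "\<dots> = distr M (PiM I (\<lambda>_. borel)) (\<lambda>\<omega>. \<lambda>i\<in>I. X n i \<omega>)"
        using elim rv I(2) by (subst (asm) indep_vars_iff_distr_eq_PiM') auto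
      also have "(\<integral>y. g n y \<partial>\<dots>) = expectation (\<lambda>\<omega>. g n (\<lambda>i\<in>I. X n i \<omega>))"
        by (subst integral_distr) auto
      finally show ?case .
    qed
  qed
qed

text \<open>Topology and product sigma-algebra are matched on nat \<Rightarrow> real, whose Borel
  sets are those of the countable product. Enumerating J transports f to a continuous F there, and f
  is F composed with a measurable embedding that fills the remaining coordinates with 0.\<close>

lemma continuous_map_borel_measurable_PiM:
  fixes f :: "('i \<Rightarrow> real) \<Rightarrow> real"
  assumes J: "countable J" and f: "continuous_map (product_topology (\<lambda>_. euclideanreal) J) euclideanreal f"
  shows "f \<in> borel_measurable (PiM J (\<lambda>_. borel))"
proof -
  define F :: "(nat \<Rightarrow> real) \<Rightarrow> real" where "F x = f (\<lambda>j\<in>J. x (to_nat_on J j))" for x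
  have "continuous_map (product_topology (\<lambda>_. euclideanreal) UNIV)
      (product_topology (\<lambda>_. euclideanreal) J) (\<lambda>x. \<lambda>j\<in>J. x (to_nat_on J j))"
    by (auto simp: continuous_map_componentwise intro!: continuous_map_product_projection)
  from continuous_map_compose[OF this f] have "continuous_map euclidean euclideanreal F"
    by (simp add: F_def comp_def euclidean_product_topology)
  then have "continuous_on UNIV F" by simp
  then have "F \<in> borel_measurable borel"
    by (rule borel_measurable_continuous_onI)
  then have [measurable]: "F \<in> borel_measurable (PiM UNIV (\<lambda>_. borel))"
    using measurable_cong_sets[OF sets_PiM_equal_borel refl] by blast
  have "(\<lambda>y. F (\<lambda>i\<in>UNIV. if i \<in> to_nat_on J ` J then y (from_nat_into J i) else 0))
      \<in> borel_measurable (PiM J (\<lambda>_. borel))"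
  proof (rule measurable_compose[OF measurable_restrict])
    fix i
    show "(\<lambda>y. if i \<in> to_nat_on J ` J then y (from_nat_into J i) else 0)
        \<in> borel_measurable (PiM J (\<lambda>_. borel))"
      using J by (cases "i \<in> to_nat_on J ` J")
        (auto intro!: measurable_component_singleton simp: from_nat_into_to_nat_on)
  qed measurable
  moreover have "F (\<lambda>i\<in>UNIV. if i \<in> to_nat_on J ` J then y (from_nat_into J i) else 0) = f y"
    if "y \<in> space (PiM J (\<lambda>_. borel))" for y
  proof -
    have "(\<lambda>j\<in>J. (\<lambda>i\<in>UNIV. if i \<in> to_nat_on J ` J then y (from_nat_into J i) else 0) (to_nat_on J j)) = y"
      using that J by (auto simp: fun_eq_iff space_PiM PiE_def extensional_def)
    then show ?thesis by (simp only: F_def)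
  qed
  ultimately show ?thesis
    by (simp cong: measurable_cong)
qed

lemma continuous_map_tendsto_componentwise:
  fixes f :: "('i \<Rightarrow> real) \<Rightarrow> real"
  assumes f: "continuous_map (product_topology (\<lambda>_. euclideanreal) J) euclideanreal f"
    and "\<And>j. j \<in> J \<Longrightarrow> (\<lambda>n. x n j) \<longlonglongrightarrow> y j"
  shows "(\<lambda>n. f (\<lambda>j\<in>J. x n j)) \<longlonglongrightarrow> f (\<lambda>j\<in>J. y j)"
proof -
  have "limitin (product_topology (\<lambda>_. euclideanreal) J) (\<lambda>n. \<lambda>j\<in>J. x n j) (\<lambda>j\<in>J. y j) sequentially"
    using assms(2) by (auto simp: limitin_componentwise)
  from continuous_map_limit[OF f this] show ?thesis by (simp add: comp_def)
qed

section \<open>Grids through finitely many times, and blocks of innovations\<close>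

lemma unit_interval_partition_through:
  assumes "finite J" "J \<subseteq> {0..1::real}"
  shows "\<exists>(k::nat) (t :: nat \<Rightarrow> real) idx. k \<ge> 1 \<and> t 0 = 0 \<and> strict_mono_on {..k} t \<and>
    t ` {..k} \<subseteq> {0..1} \<and> (\<forall>j\<in>J. idx j \<le> k \<and> t (idx j) = j)"
proof -
  \<comment> \<open>The point 0 is where Brownian motion starts, so values at grid points become
    sums of increments. Together with 1 it ensures at least one increment, also when J is
    empty.\<close>
  define S where "S = insert 0 (insert 1 J)"
  define xs where "xs = sorted_list_of_set S"
  have S: "finite S" "S \<subseteq> {0..1}" using assms by (auto simp: S_def)
  have xs: "sorted_wrt (<) xs" "set xs = S" "length xs = card S"
    using S by (auto simp: xs_def)
  have "card {0, 1::real} \<le> card S" using S by (intro card_mono) (auto simp: S_def)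
  then have card: "2 \<le> card S" by simp
  have "\<exists>i. i < length xs \<and> xs ! i = j" if "j \<in> S" for j
    using that xs(2) by (auto simp: in_set_conv_nth)
  then obtain idx where idx: "\<And>j. j \<in> S \<Longrightarrow> idx j < length xs \<and> xs ! idx j = j" by metis
  have "xs ! i < xs ! j" if "i < j" "j \<le> card S - 1" for i j
    using that xs(3) card by (intro sorted_wrt_nth_less[OF xs(1)]) auto
  then have mono: "strict_mono_on {..card S - 1} (\<lambda>i. xs ! i)"
    by (auto simp: strict_mono_on_def)
  have img: "(\<lambda>i. xs ! i) ` {..card S - 1} \<subseteq> {0..1}"
  proof clarify
    fix i assume "i \<le> card S - 1"
    then have "i < length xs" using xs(3) card by linarith
    then have "xs ! i \<in> S" using xs(2) nth_mem by blast
    then show "xs ! i \<in> {0..1}" using S by auto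
  qed
  have "xs ! 0 = 0"
  proof (rule ccontr)
    assume neq: "xs ! 0 \<noteq> 0"
    have i: "idx 0 < length xs" "xs ! idx 0 = 0" using idx[of 0] by (auto simp: S_def)
    with neq have "0 < idx 0" by (metis gr0I)
    with xs(1) i have "xs ! 0 < 0" using sorted_wrt_nth_less[of "(<)" xs 0 "idx 0"] by simp
    moreover have "xs ! 0 \<in> {0..1}" using img by blast
    ultimately show False by simp
  qed
  moreover have "\<forall>j\<in>J. idx j \<le> card S - 1 \<and> xs ! idx j = j"
  proof
    fix j assume "j \<in> J"
    then have "idx j < length xs" "xs ! idx j = j" using idx[of j] by (auto simp: S_def)
    then show "idx j \<le> card S - 1 \<and> xs ! idx j = j" using xs(3) by linarith
  qed
  moreover have "1 \<le> card S - 1" using card by linarith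
  ultimately show ?thesis
    using mono img by (intro exI[of _ "card S - 1"] exI[of _ "\<lambda>i. xs ! i"] exI[of _ idx] conjI)
qed

text \<open>The innovation \<open>q i + 1\<close> shared by two adjacent increments of the interpolation forms
  a block of its own, so that distinct blocks are independent.\<close>

definition block :: "(nat \<Rightarrow> nat) \<Rightarrow> nat \<Rightarrow> nat \<times> bool \<Rightarrow> nat set" where
  "block q k = (\<lambda>(i, b). if b then if i < k then {q i + 2..q (Suc i)} else {} else {q i + 1})"

lemma block_subset: "block q k c \<subseteq> {1..}" and finite_block: "finite (block q k c)"
  by (auto simp: block_def split: prod.split)

text \<open>For i < k both blocks of index i lie between q i + 1 and q (i + 1); strict growth of q
  leaves room for the singleton. The singleton of index k lies beyond q k.\<close>

lemma disjoint_family_block: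
  assumes q: "\<And>i. i < k \<Longrightarrow> q i < q (Suc i)"
  shows "disjoint_family_on (block q k) ({..k} \<times> UNIV)"
proof -
  have mono: "q i \<le> q j" if "i \<le> j" "j \<le> k" for i j
    using that
  proof (induction j rule: dec_induct)
    case (step j)
    then show ?case using q[of j] by simp
  qed simp
  have le: "x \<le> q (Suc i)" if "x \<in> block q k (i, b)" "i < k" for x i b
    using that q[of i] by (auto simp: block_def split: if_splits)
  have gt: "q i < x" if "x \<in> block q k (i, b)" for x i b
    using that by (auto simp: block_def split: if_splits)
  have disj: "block q k (i, b) \<inter> block q k (j, b') = {}" if "i < j" "j \<le> k" for i j b b'
  proof -
    have "q (Suc i) \<le> q j" using that by (intro mono) auto
    then show ?thesis using le[of _ i b] gt[of _ j b'] that by fastforce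
  qed
  have "block q k (i, b) \<inter> block q k (i, b') = {}" if "b \<noteq> b'" for i b b'
    using that by (auto simp: block_def)
  note same = this
  show ?thesis
    unfolding disjoint_family_on_def
  proof (intro ballI impI)
    fix c c' :: "nat \<times> bool" assume "c \<in> {..k} \<times> UNIV" "c' \<in> {..k} \<times> UNIV" "c \<noteq> c'"
    moreover obtain i b j b' where c: "c = (i, b)" "c' = (j, b')" by (cases c; cases c')
    ultimately have ij: "i \<in> {..k}" "j \<in> {..k}" and ne: "(i, b) \<noteq> (j, b')" by auto
    consider "i < j" | "j < i" | "i = j" by linarith
    then show "block q k c \<inter> block q k c' = {}"
    proof cases
      case 1
      then show ?thesis unfolding c using ij by (intro disj) auto
    next
      case 2
      then have "block q k (j, b') \<inter> block q k (i, b) = {}" using ij by (intro disj) auto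
      then show ?thesis unfolding c by (simp only: Int_commute)
    next
      case 3
      then show ?thesis unfolding c using ne same[of b b' i] by simp
    qed
  qed
qed

lemma sum_blocks:
  fixes f :: "nat \<Rightarrow> real"
  assumes "\<And>i. i < k \<Longrightarrow> q i < q (Suc i)" "q 0 = 0" "m \<le> k"
  shows "sum f {1..q m} = (\<Sum>i<m. sum f (block q k (i, True)) + sum f (block q k (i, False)))"
  using \<open>m \<le> k\<close>
proof (induction m)
  case (Suc m)
  then have "{1..q (Suc m)} = {1..q m} \<union> insert (q m + 1) {q m + 2..q (Suc m)}"
    using assms(1)[of m] by auto
  then have "sum f {1..q (Suc m)} = sum f {1..q m} + sum f (insert (q m + 1) {q m + 2..q (Suc m)})"
    by (simp only:) (rule sum.union_disjoint, auto)
  with Suc show ?case by (simp add: block_def)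
qed (simp add: assms)

lemma nat_floor_over_n_tendsto:
  assumes "0 \<le> u"
  shows "(\<lambda>n. real (nat \<lfloor>u * real n\<rfloor>) / real n) \<longlonglongrightarrow> u"
proof (rule tendsto_sandwich)
  have bounds: "u * real n - 1 \<le> real (nat \<lfloor>u * real n\<rfloor>)" "real (nat \<lfloor>u * real n\<rfloor>) \<le> u * real n" for n
    using assms by (auto simp: of_nat_nat)
  show "(\<lambda>n. u - 1 / real n) \<longlonglongrightarrow> u" by real_asymp
  show "\<forall>\<^sub>F n in sequentially. u - 1 / real n \<le> real (nat \<lfloor>u * real n\<rfloor>) / real n"
    using eventually_gt_at_top[of 0]
  proof eventually_elim
    case (elim n)
    then have "u - 1 / real n = (u * real n - 1) / real n" by (simp add: field_simps)
    also have "\<dots> \<le> real (nat \<lfloor>u * real n\<rfloor>) / real n"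
      by (intro divide_right_mono bounds) simp
    finally show ?case .
  qed
  show "\<forall>\<^sub>F n in sequentially. real (nat \<lfloor>u * real n\<rfloor>) / real n \<le> u"
    using eventually_gt_at_top[of 0]
    by eventually_elim (use bounds in \<open>simp add: field_simps\<close>)
qed simp

lemma (in prob_space) indep_vars_block_sums:
  fixes \<eta> :: "nat \<Rightarrow> 'a \<Rightarrow> real"
  assumes "indep_vars (\<lambda>_. borel) \<eta> I" "\<And>c. c \<in> L \<Longrightarrow> A c \<subseteq> I" "disjoint_family_on A L"
  shows "indep_vars (\<lambda>_. borel) (\<lambda>c \<omega>. (\<Sum>t\<in>A c. \<eta> t \<omega>) / a) L"
proof -
  have "indep_vars (\<lambda>_. borel) (\<lambda>c \<omega>. (\<Sum>t\<in>A c. (\<lambda>i\<in>A c. \<eta> i \<omega>) t) / a) L"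
    by (rule indep_vars_compose2[OF indep_vars_restrict[OF assms]]) measurable
  then show ?thesis by (simp cong: sum.cong)
qed

text \<open>On a grid through J the interpolation is a function of independent block sums. The
  singleton blocks vanish in the limit, and with them the fractional terms, while the long blocks
  converge to independent normal variables with the laws of the increments of
  \<open>W\<close>.\<close>

lemma (in prob_space) interp_partial_sum_marginals_weak_conv:
  fixes \<eta> :: "nat \<Rightarrow> 'a \<Rightarrow> real"
  assumes indep: "indep_vars (\<lambda>_. borel) \<eta> {1..}"
    and law: "\<And>t. t \<ge> 1 \<Longrightarrow> distr M borel (\<eta> t) = normal_mixture p s r"
    and psr: "0 \<le> p" "p \<le> 1" "0 < s" "0 < r" "(1 - p) * s\<^sup>2 + p * r\<^sup>2 = 1"
    and W: "standard_brownian_motion N W" and J: "finite J" "J \<subseteq> {0..1}"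
  shows "weak_conv_vec J (\<lambda>n. marginal M (interp_partial_sum \<eta> n) J) (marginal N W J)"
  unfolding weak_conv_vec_def
proof clarify
  fix f :: "(real \<Rightarrow> real) \<Rightarrow> real"
  assume f: "continuous_map (product_topology (\<lambda>_. euclideanreal) J) euclideanreal f"
    and "bounded (f ` (\<Pi>\<^sub>E j\<in>J. UNIV))"
  then obtain B where B: "\<And>y. y \<in> (\<Pi>\<^sub>E j\<in>J. UNIV) \<Longrightarrow> \<bar>f y\<bar> \<le> B"
    by (auto simp: bounded_iff)
  have f_meas [measurable]: "f \<in> borel_measurable (PiM J (\<lambda>_. borel))"
    using J f by (intro continuous_map_borel_measurable_PiM) (auto simp: countable_finite)
  obtain k :: nat and t idx where k: "k \<ge> 1" and t0: "t 0 = 0" and t_mono: "strict_mono_on {..k} t"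
    and t_range: "t ` {..k} \<subseteq> {0..1}" and idx_t: "\<forall>j\<in>J. idx j \<le> k \<and> t (idx j) = j"
    using unit_interval_partition_through[OF J] by blast
  have idx: "idx j \<le> k" and t_idx: "t (idx j) = j" if "j \<in> J" for j
    using idx_t that by auto
  have t_less: "t i < t (Suc i)" if "i < k" for i
    using t_mono that by (auto simp: strict_mono_on_def)
  have t_unit: "0 \<le> t i" "t i \<le> 1" if "i \<le> k" for i
    using t_range that by auto
  \<comment> \<open>The index k is included for the innovation q k + 1, which carries the fractional
    term at the last grid point; the other block of index k is empty.\<close>
  define I where "I = {..k} \<times> (UNIV :: bool set)"
  have I: "finite I" "I \<noteq> {}" by (auto simp: I_def)
  define q where "q n i = nat \<lfloor>t i * real n\<rfloor>" for n i
  define X where "X n c \<omega> = (\<Sum>t\<in>block (q n) k c. \<eta> t \<omega>) / sqrt (real n)" for n c \<omega>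
  define d where "d c = (if snd c \<and> fst c < k then t (Suc (fst c)) - t (fst c) else 0)" for c :: "nat \<times> bool"
  define \<nu> where "\<nu> c = centered_normal (d c)" for c
  define frac where "frac n i = t i * real n - of_int \<lfloor>t i * real n\<rfloor>" for n i
  \<comment> \<open>The fractional parts need not converge, so this function varies with n. They are
    bounded, however, so it still converges along sequences whose singleton coordinates tend to
    0.\<close>
  define g where "g n y = f (\<lambda>j\<in>J. (\<Sum>i<idx j. y (i, True) + y (i, False)) + frac n (idx j) * y (idx j, False))"
    for n and y :: "nat \<times> bool \<Rightarrow> real"
  define H where "H x = f (\<lambda>j\<in>J. \<Sum>i<idx j. x i)" for x :: "nat \<Rightarrow> real"
  have \<eta>_meas [measurable]: "\<eta> i \<in> borel_measurable M" if "i \<ge> 1" for i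
    using indep that by (auto simp: indep_vars_def)
  have [measurable]: "\<eta> i \<in> borel_measurable M" if "i \<in> block q' k c" for i q' c
    using \<eta>_meas that block_subset[of q' k c] by fastforce
  have q0: "q n 0 = 0" for n by (simp add: q_def t0)
  have q_lim: "(\<lambda>n. real (q n i) / real n) \<longlonglongrightarrow> t i" if "i \<le> k" for i
    unfolding q_def by (rule nat_floor_over_n_tendsto[OF t_unit(1)[OF that]])
  \<comment> \<open>For small n several grid points may have the same floor; the blocks are known to
    be disjoint only once n separates the grid.\<close>
  have q_less: "\<forall>\<^sub>F n in sequentially. q n i < q n (Suc i)" if "i < k" for i
  proof -
    have "(\<lambda>n. real (q n (Suc i)) / real n - real (q n i) / real n) \<longlonglongrightarrow> t (Suc i) - t i"
      using that by (intro tendsto_diff q_lim) auto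
    from order_tendstoD(1)[OF this, of 0]
    have "\<forall>\<^sub>F n in sequentially. 0 < real (q n (Suc i)) / real n - real (q n i) / real n"
      using t_less[OF that] by simp
    then show ?thesis
    proof eventually_elim
      case (elim n)
      then have "real (q n i) / real n < real (q n (Suc i)) / real n" by simp
      then show ?case by (simp add: divide_less_cancel split: if_splits)
    qed
  qed
  then have "\<forall>\<^sub>F n in sequentially. \<forall>i\<in>{..<k}. q n i < q n (Suc i)"
    by (intro eventually_ball_finite) auto
  then have q_strict: "\<forall>\<^sub>F n in sequentially. \<forall>i<k. q n i < q n (Suc i)"
    by (rule eventually_mono) auto
  have d_lim: "(\<lambda>n. real (card (block (q n) k c)) / real n) \<longlonglongrightarrow> d c" if "c \<in> I" for c
  proof (cases "snd c \<and> fst c < k")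
    case True
    define i where "i = fst c"
    have c: "c = (i, True)" "i < k" using True by (cases c; simp add: i_def)+
    \<comment> \<open>The long block has q (i + 1) - q i - 1 elements, the first innovation of the
      interval having been split off; the term 1/n accounts for it.\<close>
    have "(\<lambda>n. real (q n (Suc i)) / real n - real (q n i) / real n - 1 / real n) \<longlonglongrightarrow> t (Suc i) - t i - 0"
      using c by (intro tendsto_diff q_lim) (auto intro: lim_1_over_n)
    then have "(\<lambda>n. real (card (block (q n) k c)) / real n) \<longlonglongrightarrow> t (Suc i) - t i - 0"
    proof (rule Lim_transform_eventually)
      show "\<forall>\<^sub>F n in sequentially. real (q n (Suc i)) / real n - real (q n i) / real n - 1 / real n
          = real (card (block (q n) k c)) / real n"
        using q_less[OF c(2)]
        by eventually_elim (simp add: c block_def of_nat_diff diff_divide_distrib add_divide_distrib)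
    qed
    then show ?thesis using c by (simp add: d_def)
  next
    case False
    then have "card (block (q n) k c) = (if snd c then 0 else 1)" for n
      by (cases c) (auto simp: block_def)
    then show ?thesis using False by (auto simp: d_def intro: lim_1_over_n)
  qed
  have X_meas [measurable]: "X n c \<in> borel_measurable M" for n c
    unfolding X_def[abs_def] by measurable
  have g_meas: "g n \<in> borel_measurable (PiM I (\<lambda>_. borel))" for n
  proof -
    have [measurable]: "(\<lambda>y. \<lambda>j\<in>J. (\<Sum>i<idx j. y (i, True) + y (i, False)) + frac n (idx j) * y (idx j, False))
        \<in> measurable (PiM I (\<lambda>_. borel)) (PiM J (\<lambda>_. borel))"
    proof (rule measurable_restrict)
      fix j assume "j \<in> J"
      then have "idx j \<le> k" by (rule idx)
      then show "(\<lambda>y. (\<Sum>i<idx j. y (i, True) + y (i, False)) + frac n (idx j) * y (idx j, False))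
          \<in> borel_measurable (PiM I (\<lambda>_. borel))"
        by (intro borel_measurable_add borel_measurable_sum borel_measurable_times
            borel_measurable_const measurable_component_singleton) (auto simp: I_def)
    qed
    show ?thesis unfolding g_def[abs_def] by measurable
  qed
  have H_meas [measurable]: "H \<in> borel_measurable (PiM {..<k} (\<lambda>_. borel))"
  proof -
    have [measurable]: "(\<lambda>y. \<lambda>j\<in>J. \<Sum>i<idx j. y i)
        \<in> measurable (PiM {..<k} (\<lambda>_. borel :: real measure)) (PiM J (\<lambda>_. borel))"
    proof (rule measurable_restrict)
      fix j assume "j \<in> J"
      then have "(\<lambda>y. y i) \<in> borel_measurable (PiM {..<k} (\<lambda>_. borel :: real measure))"
        if "i \<in> {..<idx j}" for i
        using idx[of j] that by (intro measurable_component_singleton) auto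
      then show "(\<lambda>y. \<Sum>i<idx j. y i) \<in> borel_measurable (PiM {..<k} (\<lambda>_. borel :: real measure))"
        by (rule borel_measurable_sum)
    qed
    show ?thesis unfolding H_def[abs_def] by measurable
  qed
  have G_meas [measurable]: "(\<lambda>y. H (\<lambda>i\<in>{..<k}. y (i, True))) \<in> borel_measurable (PiM I (\<lambda>_. borel))"
    by (rule measurable_compose[OF measurable_restrict H_meas])
      (auto simp: I_def intro!: measurable_component_singleton)
  have \<nu>_distr: "real_distribution (\<nu> c)" for c
    by (simp add: \<nu>_def real_distribution_centered_normal)
  then have \<nu>_prob: "prob_space (\<nu> c)" for c
    by (simp add: real_distribution_def)
  have "(\<lambda>n. expectation (\<lambda>\<omega>. g n (\<lambda>c\<in>I. X n c \<omega>)))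
      \<longlonglongrightarrow> (\<integral>y. H (\<lambda>i\<in>{..<k}. y (i, True)) \<partial>PiM I \<nu>)"
  proof (rule indep_expectation_tendsto[OF I X_meas _ \<nu>_distr _ g_meas G_meas])
    show "\<forall>\<^sub>F n in sequentially. indep_vars (\<lambda>_. borel) (X n) I"
      using q_strict
    proof eventually_elim
      case (elim n)
      then show ?case
        unfolding X_def[abs_def] I_def
        by (intro indep_vars_block_sums[OF indep] block_subset disjoint_family_block) auto
    qed
    show "weak_conv_m (\<lambda>n. distr M borel (X n c)) (\<nu> c)" if "c \<in> I" for c
      unfolding X_def[abs_def] \<nu>_def
      by (rule block_sum_weak_conv[OF indep law psr finite_block block_subset d_lim[OF that]])
    show "\<bar>g n y\<bar> \<le> B" for n y unfolding g_def by (rule B) auto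
    \<comment> \<open>Singleton blocks have limit variance 0, so the points at which convergence of
      \<open>g n\<close> has to be checked have vanishing singleton coordinates.\<close>
    have "AE y in PiM I \<nu>. \<forall>i\<in>{..k}. y (i, False) = 0"
    proof (intro AE_finite_allI AE_PiM_component[where P = "\<lambda>x. x = 0"])
      fix i assume "i \<in> {..k}"
      then show "(i, False) \<in> I" by (simp add: I_def)
      show "AE x in \<nu> (i, False). x = 0"
        unfolding \<nu>_def d_def using AE_centered_normal_0 by simp
    qed (simp_all add: \<nu>_prob)
    then show "AE y in PiM I \<nu>. \<forall>Y. (\<forall>c\<in>I. (\<lambda>n. Y n c) \<longlonglongrightarrow> y c) \<longrightarrow>
        (\<lambda>n. g n (Y n)) \<longlonglongrightarrow> H (\<lambda>i\<in>{..<k}. y (i, True))"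
    proof eventually_elim
      case (elim y)
      show ?case
      proof (intro allI impI)
        fix Y :: "nat \<Rightarrow> nat \<times> bool \<Rightarrow> real"
        assume "\<forall>c\<in>I. (\<lambda>n. Y n c) \<longlonglongrightarrow> y c"
        then have Y: "(\<lambda>n. Y n (i, b)) \<longlonglongrightarrow> y (i, b)" if "i \<le> k" for i b
          using that by (simp add: I_def)
        have "(\<lambda>n. frac n i * Y n (i, False)) \<longlonglongrightarrow> 0" if "i \<le> k" for i
        proof (rule Lim_null_comparison)
          show "(\<lambda>n. \<bar>Y n (i, False)\<bar>) \<longlonglongrightarrow> 0"
            using Y[OF that, of False] elim that by (simp add: tendsto_rabs_zero_iff)
          have "\<bar>frac n i\<bar> \<le> 1" for n unfolding frac_def by linarith
          then show "\<forall>\<^sub>F n in sequentially. norm (frac n i * Y n (i, False)) \<le> \<bar>Y n (i, False)\<bar>"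
            by (simp add: abs_mult mult_left_le_one_le)
        qed
        then have "(\<lambda>n. (\<Sum>i<idx j. Y n (i, True) + Y n (i, False)) + frac n (idx j) * Y n (idx j, False))
            \<longlonglongrightarrow> (\<Sum>i<idx j. y (i, True) + y (i, False)) + 0" if "j \<in> J" for j
          using idx[OF that] by (intro tendsto_add tendsto_sum Y) auto
        then have "(\<lambda>n. g n (Y n)) \<longlonglongrightarrow> f (\<lambda>j\<in>J. (\<Sum>i<idx j. y (i, True) + y (i, False)) + 0)"
          unfolding g_def by (intro continuous_map_tendsto_componentwise[OF f])
        also have "(\<lambda>j\<in>J. (\<Sum>i<idx j. y (i, True) + y (i, False)) + 0)
            = (\<lambda>j\<in>J. \<Sum>i<idx j. (\<lambda>i\<in>{..<k}. y (i, True)) i)"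
          using elim by (auto simp: fun_eq_iff restrict_def dest!: idx intro!: sum.cong)
        finally show "(\<lambda>n. g n (Y n)) \<longlonglongrightarrow> H (\<lambda>i\<in>{..<k}. y (i, True))"
          by (simp only: H_def)
      qed
    qed
  qed
  also have "(\<integral>y. H (\<lambda>i\<in>{..<k}. y (i, True)) \<partial>PiM I \<nu>) = (\<integral>x. f x \<partial>marginal N W J)"
  proof -
    interpret N: prob_space N using W by (simp add: standard_brownian_motion_def)
    have W_meas [measurable]: "W u \<in> borel_measurable N" if "u \<in> {0..1}" for u
      using W that by (simp add: standard_brownian_motion_def)
    have W_meas_t [measurable]: "W (t i) \<in> borel_measurable N" if "i \<le> k" for i
      using W_meas t_unit[OF that] by simp
    define D where "D i \<omega> = W (t (Suc i)) \<omega> - W (t i) \<omega>" for i \<omega>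
    have D_meas [measurable]: "D i \<in> borel_measurable N" if "i < k" for i
      unfolding D_def[abs_def] using that by (intro borel_measurable_diff W_meas_t) auto
    have "mono_on {..k} t" using t_mono by (rule strict_mono_on_imp_mono_on)
    then have D_indep: "N.indep_vars (\<lambda>_. borel) D {..<k}"
      using W t_range unfolding D_def[abs_def] standard_brownian_motion_def by blast
    have D_law: "distr N borel (D i) = \<nu> (i, True)" if "i < k" for i
      unfolding \<nu>_def D_def[abs_def]
    proof (rule distributed_normal_density_imp_centered_normal)
      show "distributed N lborel (\<lambda>\<omega>. W (t (Suc i)) \<omega> - W (t i) \<omega>)
          (\<lambda>x. ennreal (normal_density 0 (sqrt (d (i, True))) x))"
        using W t_less[OF that] t_unit[of i] t_unit[of "Suc i"] that
        by (simp add: standard_brownian_motion_def d_def)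
    qed (use t_less[OF that] that in \<open>simp add: d_def\<close>)
    \<comment> \<open>The long-block coordinates have a product law under the limit measure, and by
      independence of the increments it is the joint law of \<open>D\<close>.\<close>
    have "(\<integral>y. H (\<lambda>i\<in>{..<k}. y (i, True)) \<partial>PiM I \<nu>)
        = (\<integral>x. H x \<partial>distr (PiM I \<nu>) (PiM {..<k} (\<lambda>i. \<nu> (i, True))) (\<lambda>y. \<lambda>i\<in>{..<k}. y (i, True)))"
    proof (subst integral_distr)
      show "(\<lambda>y. \<lambda>i\<in>{..<k}. y (i, True)) \<in> measurable (PiM I \<nu>) (PiM {..<k} (\<lambda>i. \<nu> (i, True)))"
        by (intro measurable_restrict measurable_component_singleton) (auto simp: I_def)
      have "sets (PiM {..<k} (\<lambda>i. \<nu> (i, True))) = sets (PiM {..<k} (\<lambda>_. borel))"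
        by (intro sets_PiM_cong) (auto simp: \<nu>_def centered_normal_def)
      then show "H \<in> borel_measurable (PiM {..<k} (\<lambda>i. \<nu> (i, True)))"
        using H_meas measurable_cong_sets by blast
    qed simp
    also have "distr (PiM I \<nu>) (PiM {..<k} (\<lambda>i. \<nu> (i, True))) (\<lambda>y. \<lambda>i\<in>{..<k}. y (i, True))
        = PiM {..<k} (\<lambda>i. \<nu> (i, True))"
      by (rule distr_PiM_reindex) (auto simp: \<nu>_prob I_def inj_on_def)
    also have "\<dots> = PiM {..<k} (\<lambda>i. distr N borel (D i))"
      by (intro PiM_cong) (auto simp: D_law)
    also have "\<dots> = distr N (PiM {..<k} (\<lambda>_. borel)) (\<lambda>\<omega>. \<lambda>i\<in>{..<k}. D i \<omega>)"
      using D_indep k by (subst (asm) N.indep_vars_iff_distr_eq_PiM') (auto simp: lessThan_empty_iff)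
    also have "(\<integral>x. H x \<partial>\<dots>) = (\<integral>\<omega>. H (\<lambda>i\<in>{..<k}. D i \<omega>) \<partial>N)"
      by (subst integral_distr) (auto intro!: measurable_restrict)
    also have "\<dots> = (\<integral>\<omega>. f (\<lambda>j\<in>J. W j \<omega>) \<partial>N)"
    proof (rule integral_cong_AE)
      show "(\<lambda>\<omega>. H (\<lambda>i\<in>{..<k}. D i \<omega>)) \<in> borel_measurable N"
        by (rule measurable_compose[OF measurable_restrict H_meas]) auto
      show "(\<lambda>\<omega>. f (\<lambda>j\<in>J. W j \<omega>)) \<in> borel_measurable N"
        using J by (intro measurable_compose[OF measurable_restrict f_meas] W_meas) auto
      \<comment> \<open>The increments telescope to W j - W 0, and W 0 vanishes only almost
        surely.\<close>
      have "AE \<omega> in N. W 0 \<omega> = 0" using W by (simp add: standard_brownian_motion_def)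
      then show "AE \<omega> in N. H (\<lambda>i\<in>{..<k}. D i \<omega>) = f (\<lambda>j\<in>J. W j \<omega>)"
      proof eventually_elim
        case (elim \<omega>)
        have "(\<Sum>i<idx j. (\<lambda>i\<in>{..<k}. D i \<omega>) i) = W j \<omega>" if "j \<in> J" for j
        proof -
          have "(\<Sum>i<idx j. (\<lambda>i\<in>{..<k}. D i \<omega>) i) = (\<Sum>i<idx j. W (t (Suc i)) \<omega> - W (t i) \<omega>)"
            using idx[OF that] by (intro sum.cong) (auto simp: D_def)
          also have "\<dots> = W (t (idx j)) \<omega> - W (t 0) \<omega>" by (rule sum_lessThan_telescope)
          finally show ?thesis using that by (simp add: t_idx t0 elim)
        qed
        then show ?case by (simp add: H_def cong: restrict_cong)
      qed
    qed
    also have "\<dots> = (\<integral>x. f x \<partial>marginal N W J)"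
      unfolding marginal_def using J
      by (subst integral_distr) (auto intro!: measurable_restrict W_meas)
    finally show ?thesis .
  qed
  finally show "(\<lambda>n. \<integral>x. f x \<partial>marginal M (interp_partial_sum \<eta> n) J) \<longlonglongrightarrow> (\<integral>x. f x \<partial>marginal N W J)"
  proof (rule Lim_transform_eventually)
    show "\<forall>\<^sub>F n in sequentially. expectation (\<lambda>\<omega>. g n (\<lambda>c\<in>I. X n c \<omega>))
        = (\<integral>x. f x \<partial>marginal M (interp_partial_sum \<eta> n) J)"
      using q_strict
    proof eventually_elim
      case (elim n)
      have S: "interp_partial_sum \<eta> n j \<omega>
          = (\<Sum>i<idx j. X n (i, True) \<omega> + X n (i, False) \<omega>) + frac n (idx j) * X n (idx j, False) \<omega>"
        if "j \<in> J" for j \<omega>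
      proof -
        have "interp_partial_sum \<eta> n j \<omega> = (\<Sum>t = 1..q n (idx j). \<eta> t \<omega>) / sqrt (real n)
            + frac n (idx j) * \<eta> (q n (idx j) + 1) \<omega> / sqrt (real n)"
          using that by (simp add: interp_partial_sum_def q_def frac_def t_idx)
        also have "(\<Sum>t = 1..q n (idx j). \<eta> t \<omega>)
            = (\<Sum>i<idx j. (\<Sum>t\<in>block (q n) k (i, True). \<eta> t \<omega>) + (\<Sum>t\<in>block (q n) k (i, False). \<eta> t \<omega>))"
          using elim by (intro sum_blocks q0 idx that) auto
        finally show ?thesis
          by (simp add: X_def sum_divide_distrib add_divide_distrib block_def)
      qed
      have [measurable]: "interp_partial_sum \<eta> n j \<in> borel_measurable M" for j
        unfolding interp_partial_sum_def[abs_def] by measurable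
      have "g n (\<lambda>c\<in>I. X n c \<omega>) = f (\<lambda>j\<in>J. interp_partial_sum \<eta> n j \<omega>)" for \<omega>
        unfolding g_def
      proof (intro arg_cong[where f = f] restrict_ext)
        fix j assume j: "j \<in> J"
        have "(i, b) \<in> I" if "i \<le> idx j" for i b
          using that idx[OF j] by (simp add: I_def)
        then show "(\<Sum>i<idx j. (\<lambda>c\<in>I. X n c \<omega>) (i, True) + (\<lambda>c\<in>I. X n c \<omega>) (i, False))
            + frac n (idx j) * (\<lambda>c\<in>I. X n c \<omega>) (idx j, False) = interp_partial_sum \<eta> n j \<omega>"
          unfolding S[OF j] by (auto intro!: arg_cong2[where f = "(+)"] sum.cong)
      qed
      then show ?case
        unfolding marginal_def by (subst integral_distr) auto
    qed
  qed
qed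

section \<open>Lower bound for the seminorm\<close>

text \<open>The supremum is over uncountably many pairs, but a supremum of continuous functions is
  lower semicontinuous: its strict superlevel sets are open, which makes it Borel
  measurable.\<close>

lemma modulus_seminorm_superlevel_borel:
  fixes \<eta> :: "nat \<Rightarrow> (nat \<Rightarrow> real) \<Rightarrow> real"
  assumes "\<And>t. continuous_on UNIV (\<eta> t)"
  shows "{\<omega>. ereal T \<le> modulus_seminorm \<rho> (\<lambda>u. interp_partial_sum \<eta> n u \<omega>)} \<in> sets borel"
proof -
  let ?S = "\<lambda>\<omega>. modulus_seminorm \<rho> (\<lambda>u. interp_partial_sum \<eta> n u \<omega>)"
  have cont: "continuous_on UNIV (interp_partial_sum \<eta> n u)" for u
    unfolding interp_partial_sum_def[abs_def] by (intro continuous_intros assms)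
  have "open {\<omega>. c < ?S \<omega>}" for c
  proof -
    have "{\<omega>. c < ?S \<omega>} = (\<Union>(u, v)\<in>{(u, v). u \<in> {0..1} \<and> v \<in> {0..1} \<and> u \<noteq> v}.
        {\<omega>. c < ereal (\<bar>interp_partial_sum \<eta> n u \<omega> - interp_partial_sum \<eta> n v \<omega>\<bar> / \<rho> \<bar>u - v\<bar>)})"
      unfolding modulus_seminorm_def by (auto simp: less_SUP_iff)
    also have "open \<dots>"
    proof (rule open_UN, clarify)
      fix u v :: real
      \<comment> \<open>As \<open>\<rho>\<close> is arbitrary, division is written as multiplication
        by a constant, which is continuous even where \<open>\<rho>\<close> vanishes.\<close>
      have "continuous_on UNIV (\<lambda>\<omega>. \<bar>interp_partial_sum \<eta> n u \<omega> - interp_partial_sum \<eta> n v \<omega>\<bar>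
          * inverse (\<rho> \<bar>u - v\<bar>))"
        by (intro continuous_intros cont)
      from open_Collect_less[OF continuous_on_const continuous_on_ereal[OF this], of c]
      show "open {\<omega>. c < ereal (\<bar>interp_partial_sum \<eta> n u \<omega> - interp_partial_sum \<eta> n v \<omega>\<bar>
          / \<rho> \<bar>u - v\<bar>)}"
        by (simp add: divide_inverse)
    qed
    finally show ?thesis .
  qed
  then have "{\<omega>. c < ?S \<omega>} \<in> sets borel" for c by auto
  then have "?S \<in> borel_measurable borel"
    by (intro borel_measurableI_greater) (simp add: pred_def)
  then have "{\<omega> \<in> space borel. ereal T \<le> ?S \<omega>} \<in> sets borel"
    by measurable
  then show ?thesis by simp
qed

lemma modulus_seminorm_ge_increment:
  assumes "n \<ge> 1" "k \<in> {1..n}" "c * sqrt (1 + ln (real n)) \<le> \<bar>\<eta> k \<omega>\<bar>"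
  shows "ereal c \<le> modulus_seminorm rho2 (\<lambda>u. interp_partial_sum \<eta> n u \<omega>)"
proof -
  define u v where "u = real k / real n" and "v = (real k - 1) / real n"
  have uv: "u \<in> {0..1}" "v \<in> {0..1}" "u \<noteq> v" "u - v = 1 / real n"
    using assms by (auto simp: u_def v_def field_simps)
  obtain m where k: "k = Suc m" using assms by (cases k) auto
  have "interp_partial_sum \<eta> n u \<omega> - interp_partial_sum \<eta> n v \<omega> = \<eta> k \<omega> / sqrt (real n)"
  proof -
    have "u * real n = real (Suc m)" "v * real n = real m"
      using assms by (simp_all add: u_def v_def k)
    then show ?thesis
      unfolding interp_partial_sum_def
      by (simp add: k floor_of_nat nat_int add_divide_distrib del: of_nat_Suc)
  qed
  moreover have "rho2 (1 / real n) = sqrt (1 + ln (real n)) / sqrt (real n)"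
    using assms by (simp add: rho2_def ln_mult real_sqrt_divide)
  moreover have "0 < sqrt (1 + ln (real n))"
    using assms by (simp add: add_pos_nonneg)
  ultimately have "c \<le> \<bar>interp_partial_sum \<eta> n u \<omega> - interp_partial_sum \<eta> n v \<omega>\<bar> / rho2 \<bar>u - v\<bar>"
    using assms by (simp add: uv abs_divide pos_le_divide_eq)
  also have "ereal \<dots> \<le> modulus_seminorm rho2 (\<lambda>u. interp_partial_sum \<eta> n u \<omega>)"
    unfolding modulus_seminorm_def using uv
    by (intro SUP_upper2[of "(u, v)"]) auto
  finally show ?thesis by simp
qed

text \<open>By independence the probability that no variable reaches x is a product of n factors,
  each at most 1 - q \<le> exp (- q).\<close>

lemma (in prob_space) indep_vars_prob_some_ge:
  fixes X :: "nat \<Rightarrow> 'a \<Rightarrow> real"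
  assumes indep: "indep_vars (\<lambda>_. borel) X {1..n}" and "n \<ge> 1"
    and q: "\<And>t. t \<in> {1..n} \<Longrightarrow> q \<le> prob {\<omega>\<in>space M. x \<le> \<bar>X t \<omega>\<bar>}"
  shows "1 - exp (- real n * q) \<le> prob {\<omega>\<in>space M. \<exists>t\<in>{1..n}. x \<le> \<bar>X t \<omega>\<bar>}"
proof -
  have rv [measurable]: "X t \<in> borel_measurable M" if "t \<in> {1..n}" for t
    using indep that by (auto simp: indep_vars_def)
  have "prob {\<omega>\<in>space M. \<forall>t\<in>{1..n}. X t \<omega> \<in> {y. \<bar>y\<bar> < x}}
      = (\<Prod>t\<in>{1..n}. prob {\<omega>\<in>space M. X t \<omega> \<in> {y. \<bar>y\<bar> < x}})"
  proof -
    have "prob (\<Inter>t\<in>{1..n}. X t -` {y. \<bar>y\<bar> < x} \<inter> space M)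
        = (\<Prod>t\<in>{1..n}. prob (X t -` {y. \<bar>y\<bar> < x} \<inter> space M))"
      using indep \<open>n \<ge> 1\<close> by (intro indep_varsD) auto
    moreover have "(\<Inter>t\<in>{1..n}. X t -` {y. \<bar>y\<bar> < x} \<inter> space M)
        = {\<omega>\<in>space M. \<forall>t\<in>{1..n}. X t \<omega> \<in> {y. \<bar>y\<bar> < x}}"
      using \<open>n \<ge> 1\<close> by auto
    ultimately show ?thesis by (simp add: vimage_def Int_def conj_commute)
  qed
  also have "\<dots> \<le> (\<Prod>t\<in>{1..n}. exp (- q))"
  proof (intro prod_mono conjI)
    fix t assume t: "t \<in> {1..n}"
    have "prob {\<omega>\<in>space M. X t \<omega> \<in> {y. \<bar>y\<bar> < x}} = 1 - prob {\<omega>\<in>space M. x \<le> \<bar>X t \<omega>\<bar>}"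
      using t by (subst prob_compl[symmetric]) (auto intro!: arg_cong[where f = prob])
    also have "\<dots> \<le> exp (- q)"
      using q[OF t] exp_ge_add_one_self[of "- q"] by linarith
    finally show "prob {\<omega>\<in>space M. X t \<omega> \<in> {y. \<bar>y\<bar> < x}} \<le> exp (- q)" .
  qed simp
  also have "\<dots> = exp (- real n * q)"
    by (simp flip: exp_of_nat_mult)
  finally have "1 - exp (- real n * q) \<le> 1 - prob {\<omega>\<in>space M. \<forall>t\<in>{1..n}. X t \<omega> \<in> {y. \<bar>y\<bar> < x}}"
    by simp
  also have "\<dots> = prob {\<omega>\<in>space M. \<exists>t\<in>{1..n}. x \<le> \<bar>X t \<omega>\<bar>}"
    by (subst prob_compl[symmetric]) (force simp: not_less intro!: arg_cong[where f = prob])+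
  finally show ?thesis .
qed

text \<open>This is where \<open>r\<^sup>2 = 2 * T\<^sup>2 + 2\<close> comes from: with y the
  threshold, (y + 1)^2 \<le> 2 y^2 + 2 is at most r^2 (1 + ln n), so the Gaussian exponent costs at
  most 1 + ln n / 2. The factor n thus leaves a multiple of sqrt n, written exp (ln n / 2).\<close>

lemma normal_density_threshold_limit:
  assumes "0 < T" "0 < p" and r: "r\<^sup>2 = 2 * T\<^sup>2 + 2" "0 < r"
  shows "filterlim (\<lambda>n. real n * (p * normal_density 0 r (T * sqrt (1 + ln (real n)) + 1)))
    at_top sequentially"
proof (rule filterlim_at_top_mono)
  define c where "c = p / sqrt (2 * pi * r\<^sup>2) * exp (- 1)"
  have "c > 0" using assms(2,4) by (simp add: c_def)
  then show "filterlim (\<lambda>n. c * exp (ln (real n) / 2)) at_top sequentially"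
    by real_asymp
  show "\<forall>\<^sub>F n in sequentially. c * exp (ln (real n) / 2)
      \<le> real n * (p * normal_density 0 r (T * sqrt (1 + ln (real n)) + 1))"
    using eventually_ge_at_top[of 1]
  proof eventually_elim
    case (elim n)
    define y where "y = T * sqrt (1 + ln (real n))"
    have L: "0 \<le> ln (real n)" using elim by simp
    have "(y + 1)\<^sup>2 \<le> 2 * y\<^sup>2 + 2"
      using zero_le_power2[of "y - 1"] by (simp add: power2_eq_square algebra_simps)
    also have "y\<^sup>2 = T\<^sup>2 * (1 + ln (real n))"
      using L by (simp add: y_def power_mult_distrib)
    finally have "(y + 1)\<^sup>2 \<le> 2 * (T\<^sup>2 * (1 + ln (real n))) + 2" .
    also have "\<dots> \<le> (1 + ln (real n)) * r\<^sup>2"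
      using L by (simp add: r algebra_simps)
    also have "\<dots> \<le> (1 + ln (real n) / 2) * (2 * r\<^sup>2)"
      using L by (simp add: algebra_simps)
    finally have "- 1 - ln (real n) / 2 \<le> - (y + 1)\<^sup>2 / (2 * r\<^sup>2)"
      using \<open>0 < r\<close> by (simp add: field_simps)
    then have "exp (- 1) * exp (- ln (real n) / 2) \<le> exp (- (y + 1)\<^sup>2 / (2 * r\<^sup>2))"
      by (simp flip: exp_add)
    then have "real n * (p / sqrt (2 * pi * r\<^sup>2)) * (exp (- 1) * exp (- ln (real n) / 2))
        \<le> real n * (p / sqrt (2 * pi * r\<^sup>2)) * exp (- (y + 1)\<^sup>2 / (2 * r\<^sup>2))"
      using assms by (intro mult_left_mono) auto
    also have "\<dots> = real n * (p * normal_density 0 r (y + 1))"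
      by (simp add: normal_density_def)
    also have "real n * (p / sqrt (2 * pi * r\<^sup>2)) * (exp (- 1) * exp (- ln (real n) / 2))
        = c * (exp (ln (real n)) * exp (- ln (real n) / 2))"
      using elim by (simp add: c_def)
    also have "exp (ln (real n)) * exp (- ln (real n) / 2) = exp (ln (real n) / 2)"
      by (simp flip: exp_add)
    finally show ?case by (simp add: y_def)
  qed
qed

section \<open>The counterexample on a product space\<close>

theorem proposition2p7:
  fixes T :: real
  assumes "T > 0"
  shows "\<exists>(M :: (nat \<Rightarrow> real) measure) (\<eta> :: nat \<Rightarrow> (nat \<Rightarrow> real) \<Rightarrow> real).
    prob_space M \<and>
    prob_space.indep_vars M (\<lambda>_. borel) \<eta> {1..} \<and>
    (\<forall>t\<ge>1. distr M borel (\<eta> t) = distr M borel (\<eta> 1)) \<and>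
    (\<forall>t\<ge>1. prob_space.expectation M (\<eta> t) = 0 \<and>
            prob_space.variance M (\<eta> t) = 1 \<and>
            psi2_norm M (\<eta> t) < \<infinity>) \<and>
    (\<exists>C>0. \<forall>t>C. \<exists>\<kappa>>1. \<exists>K>0. \<forall>n\<ge>1. \<forall>u\<in>{0..1}. \<forall>v\<in>{0..1}. u \<noteq> v \<longrightarrow>
       measure M {\<omega> \<in> space M.
         \<bar>interp_partial_sum \<eta> n u \<omega> - interp_partial_sum \<eta> n v \<omega>\<bar> / rho2 \<bar>u - v\<bar> > t}
       \<le> K * \<bar>u - v\<bar> powr \<kappa>) \<and>
    (\<exists>p>0. \<exists>K>0. \<forall>h\<in>{0..1}. \<forall>z\<in>{0..1}. rho2 (z * h) \<le> K * z powr p * rho2 h) \<and>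
    (\<forall>(N :: (real \<Rightarrow> real) measure) W. standard_brownian_motion N W \<longrightarrow>
       (\<forall>J. finite J \<and> J \<subseteq> {0..1} \<longrightarrow>
          weak_conv_vec J (\<lambda>n. marginal M (interp_partial_sum \<eta> n) J) (marginal N W J))) \<and>
    liminf (\<lambda>n. ereal (measure M {\<omega> \<in> space M.
      modulus_seminorm rho2 (\<lambda>u. interp_partial_sum \<eta> n u \<omega>) \<ge> ereal T})) = 1"
proof -
  \<comment> \<open>The variance is split evenly: p r^2 = 1/2 fixes p and (1 - p) s^2 = 1/2 fixes s.
    The summand 2 in r^2 also gives r^2 \<ge> 2, hence p \<le> 1/4 and s \<le> r.\<close>
  define r where "r = sqrt (2 * T\<^sup>2 + 2)"
  define p where "p = 1 / (2 * r\<^sup>2)"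
  define s where "s = sqrt (1 / (2 * (1 - p)))"
  have r: "0 < r" "r\<^sup>2 = 2 * T\<^sup>2 + 2" by (auto simp: r_def intro: add_nonneg_pos)
  then have "2 \<le> r\<^sup>2" by simp
  then have p: "0 < p" "p \<le> 1 / 4" using r(1) by (auto simp: p_def field_simps)
  then have s: "0 < s" "s\<^sup>2 = 1 / (2 * (1 - p))" by (auto simp: s_def)
  have "s\<^sup>2 \<le> 1" using p by (simp add: s field_simps)
  with \<open>2 \<le> r\<^sup>2\<close> have "s\<^sup>2 \<le> r\<^sup>2" by linarith
  then have "s \<le> r" using r(1) by (intro power2_le_imp_le[of s r]) auto
  have "(1 - p) * s\<^sup>2 = 1 / 2" using p by (simp add: s(2) field_simps)
  moreover have "p * r\<^sup>2 = 1 / 2" using r(1) by (simp add: p_def)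
  ultimately have var: "(1 - p) * s\<^sup>2 + p * r\<^sup>2 = 1" by linarith
  have p1: "0 \<le> p" "p \<le> 1" using p by auto
  define D where "D = normal_mixture p s r"
  define M :: "(nat \<Rightarrow> real) measure" where "M = PiM UNIV (\<lambda>_. D)"
  define \<eta> :: "nat \<Rightarrow> (nat \<Rightarrow> real) \<Rightarrow> real" where "\<eta> t \<omega> = \<omega> t" for t \<omega>
  have D: "prob_space D" unfolding D_def using p1 s r by (intro prob_space_normal_mixture)
  have sets_D [measurable_cong]: "sets D = sets borel" by (simp add: D_def)
  interpret M: prob_space M unfolding M_def by (rule prob_space_PiM[OF D])
  \<comment> \<open>The events of \<open>M\<close> are the Borel sets of the product topology, for
    which coordinates are continuous. This makes the seminorm event measurable, as monotonicity of
    its probability requires.\<close>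
  have "sets M = sets (PiM UNIV (\<lambda>_. borel))" unfolding M_def by (intro sets_PiM_cong sets_D refl)
  then have sets_M: "sets M = sets borel" by (simp add: sets_PiM_equal_borel)
  have space_M: "space M = UNIV" by (simp add: M_def space_PiM D_def)
  have \<eta>_meas [measurable]: "\<eta> t \<in> borel_measurable M" for t
    unfolding \<eta>_def[abs_def] M_def by measurable
  have law: "distr M borel (\<eta> t) = D" for t
  proof -
    have "distr M borel (\<eta> t) = distr M D (\<lambda>\<omega>. \<omega> t)"
      by (intro distr_cong) (auto simp: \<eta>_def sets_D)
    then show ?thesis by (simp add: M_def distr_PiM_component[OF D])
  qed
  have indep: "M.indep_vars (\<lambda>_. borel) \<eta> {1..}"
  proof -
    have "M.indep_vars (\<lambda>_. D) (\<lambda>i \<omega>. \<omega> i) UNIV"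
      unfolding M_def by (rule indep_vars_PiM_coordinates[OF D]) simp
    then have "M.indep_vars (\<lambda>_. borel) (\<lambda>i \<omega>. id (\<omega> i)) UNIV"
      by (rule M.indep_vars_compose2) (simp add: measurable_def D_def)
    then have "M.indep_vars (\<lambda>_. borel) \<eta> UNIV"
      by (simp add: \<eta>_def[abs_def])
    then show ?thesis
      by (rule M.indep_vars_subset) simp
  qed
  have nn_\<eta>: "(\<integral>\<^sup>+\<omega>. g (\<eta> t \<omega>) \<partial>M) = (\<integral>\<^sup>+x. g x \<partial>D)" if "g \<in> borel_measurable borel" for g t
    unfolding law[of t, symmetric] using that by (subst nn_integral_distr) auto
  have int_\<eta>: "(\<integral>\<omega>. g (\<eta> t \<omega>) \<partial>M) = (\<integral>x. g x \<partial>D)" if "g \<in> borel_measurable borel"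
    for g :: "real \<Rightarrow> real" and t
    unfolding law[of t, symmetric] using that by (subst integral_distr) auto
  have mean: "M.expectation (\<eta> t) = 0" for t
  proof -
    have "M.expectation (\<eta> t) = (\<integral>x. x \<partial>D)"
      by (rule int_\<eta>) simp
    also have "\<dots> = 0"
      unfolding D_def
      by (rule has_bochner_integral_integral_eq[OF has_bochner_integral_normal_mixture_id[OF p1 s(1) r(1)]])
    finally show ?thesis .
  qed
  have variance: "M.variance (\<eta> t) = 1" for t
  proof -
    have "M.variance (\<eta> t) = (\<integral>x. x\<^sup>2 \<partial>D)"
      unfolding mean diff_zero by (rule int_\<eta>) simp
    also have "\<dots> = (1 - p) * s\<^sup>2 + p * r\<^sup>2"
      unfolding D_def
      by (rule has_bochner_integral_integral_eq[OF has_bochner_integral_normal_mixture_square[OF p1 s(1) r(1)]])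
    also note var
    finally show ?thesis .
  qed
  have psi2: "psi2_norm M (\<eta> t) < \<infinity>" for t
  proof -
    have "(\<integral>\<^sup>+\<omega>. ennreal (exp ((\<eta> t \<omega>)\<^sup>2 / (2 * r)\<^sup>2)) \<partial>M) \<le> 2"
      using normal_mixture_exp_square[OF p1 s(1) \<open>s \<le> r\<close>]
      by (subst nn_\<eta>[of "\<lambda>x. ennreal (exp (x\<^sup>2 / (2 * r)\<^sup>2))"]) (auto simp: D_def)
    then have "psi2_norm M (\<eta> t) \<le> ennreal (2 * r)"
      unfolding psi2_norm_def using r by (intro INF_lower) auto
    also have "\<dots> < \<infinity>" by simp
    finally show ?thesis .
  qed
  have mgf: "(\<integral>\<^sup>+\<omega>. ennreal (exp (l * \<eta> t \<omega>)) \<partial>M) \<le> ennreal (exp (l\<^sup>2 * r\<^sup>2 / 2))" for l t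
    using normal_mixture_mgf[OF p1 s(1) \<open>s \<le> r\<close>]
    by (subst nn_\<eta>[of "\<lambda>x. ennreal (exp (l * x))"]) (auto simp: D_def)
  define tail_bound where "tail_bound t \<kappa> K \<longleftrightarrow>
      (\<forall>n\<ge>1. \<forall>u\<in>{0..1}. \<forall>v\<in>{0..1}. u \<noteq> v \<longrightarrow>
       measure M {\<omega> \<in> space M.
         \<bar>interp_partial_sum \<eta> n u \<omega> - interp_partial_sum \<eta> n v \<omega>\<bar> / rho2 \<bar>u - v\<bar> > t}
       \<le> K * \<bar>u - v\<bar> powr \<kappa>)" for t \<kappa> K
  \<comment> \<open>This is the threshold C: for positive t the exponent
    \<open>t\<^sup>2 / (2 * r\<^sup>2)\<close> exceeds 1 exactly when t > sqrt 2 * r.\<close>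
  have r2: "0 < sqrt 2 * r" using r(1) by simp
  have "\<exists>\<kappa>>1. \<exists>K>0. tail_bound t \<kappa> K" if t: "t > sqrt 2 * r" for t
  proof -
    have "(sqrt 2 * r)\<^sup>2 < t\<^sup>2" using t r2 by (intro power_strict_mono) auto
    then have "1 < t\<^sup>2 / (2 * r\<^sup>2)" using r(1) by (simp add: power_mult_distrib)
    moreover have "0 < t" using t r2 by linarith
    then have "tail_bound t (t\<^sup>2 / (2 * r\<^sup>2)) 2"
      unfolding tail_bound_def
      using r(1) by (intro allI impI ballI M.interp_partial_sum_increment_tail[OF indep mgf]) simp_all
    ultimately show ?thesis using zero_less_numeral by blast
  qed
  then have tail: "\<exists>C>0. \<forall>t>C. \<exists>\<kappa>>1. \<exists>K>0. tail_bound t \<kappa> K"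
    using r2 by blast
  have "\<exists>K>0. \<forall>h\<in>{0..1}. \<forall>z\<in>{0..1}. rho2 (z * h) \<le> K * z powr (1/4) * rho2 h"
    using rho2_scaling by (intro exI[of _ "sqrt 2"] conjI) auto
  moreover have "(0::real) < 1/4" by simp
  ultimately have scaling: "\<exists>p>0. \<exists>K>0. \<forall>h\<in>{0..1}. \<forall>z\<in>{0..1}.
      rho2 (z * h) \<le> K * z powr p * rho2 h"
    by blast
  have fdd: "weak_conv_vec J (\<lambda>n. marginal M (interp_partial_sum \<eta> n) J) (marginal N W J)"
    if "standard_brownian_motion N W" "finite J" "J \<subseteq> {0..1}"
    for N :: "(real \<Rightarrow> real) measure" and W J
    using p1 s(1) r(1) var that law
    by (intro M.interp_partial_sum_marginals_weak_conv[OF indep]) (auto simp: D_def)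
  let ?P = "\<lambda>n. measure M {\<omega> \<in> space M.
      modulus_seminorm rho2 (\<lambda>u. interp_partial_sum \<eta> n u \<omega>) \<ge> ereal T}"
  \<comment> \<open>Lower bound for the probability that one innovation reaches the threshold. The
    shift by 1 comes from taking the density at the right end of a unit interval.\<close>
  define q where "q n = p * normal_density 0 r (T * sqrt (1 + ln (real n)) + 1)" for n :: nat
  have lower: "1 - exp (- (real n * q n)) \<le> ?P n" if "n \<ge> 1" for n
  proof -
    let ?x = "T * sqrt (1 + ln (real n))"
    have x: "0 \<le> ?x" using that \<open>T > 0\<close> by simp
    have "q n \<le> M.prob {\<omega>\<in>space M. ?x \<le> \<bar>\<eta> t \<omega>\<bar>}" for t
    proof -
      have "q n \<le> measure D {y. ?x \<le> \<bar>y\<bar>}"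
        unfolding q_def D_def using p1 s(1) r(1) x by (rule normal_mixture_tail_lower_bound)
      also have "\<dots> = measure (distr M borel (\<eta> t)) {y. ?x \<le> \<bar>y\<bar>}" by (simp add: law)
      also have "\<dots> = M.prob {\<omega>\<in>space M. ?x \<le> \<bar>\<eta> t \<omega>\<bar>}"
        by (subst measure_distr) (auto intro!: arg_cong[where f = M.prob])
      finally show ?thesis .
    qed
    moreover have "M.indep_vars (\<lambda>_. borel) \<eta> {1..n}"
      by (rule M.indep_vars_subset[OF indep]) auto
    ultimately have "1 - exp (- real n * q n) \<le> M.prob {\<omega>\<in>space M. \<exists>t\<in>{1..n}. ?x \<le> \<bar>\<eta> t \<omega>\<bar>}"
      using that by (intro M.indep_vars_prob_some_ge) auto
    also have "\<dots> \<le> ?P n"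
    proof (rule M.finite_measure_mono)
      show "{\<omega>\<in>space M. \<exists>t\<in>{1..n}. ?x \<le> \<bar>\<eta> t \<omega>\<bar>} \<subseteq>
          {\<omega>\<in>space M. modulus_seminorm rho2 (\<lambda>u. interp_partial_sum \<eta> n u \<omega>) \<ge> ereal T}"
        using that by (auto intro!: modulus_seminorm_ge_increment)
      have "continuous_on UNIV (\<eta> t)" for t
        unfolding \<eta>_def[abs_def] by (rule continuous_on_product_coordinates)
      then show "{\<omega>\<in>space M. modulus_seminorm rho2 (\<lambda>u. interp_partial_sum \<eta> n u \<omega>) \<ge> ereal T} \<in> sets M"
        using modulus_seminorm_superlevel_borel[of \<eta> T rho2 n] by (simp add: sets_M space_M)
    qed
    finally show ?thesis by simp
  qed
  have "?P \<longlonglongrightarrow> 1"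
  proof (rule tendsto_sandwich[where h = "\<lambda>_. 1"])
    have "filterlim (\<lambda>n. real n * q n) at_top sequentially"
      unfolding q_def using \<open>T > 0\<close> p(1) r(2,1) by (rule normal_density_threshold_limit)
    then have "(\<lambda>n. exp (- (real n * q n))) \<longlonglongrightarrow> 0"
      by (intro filterlim_compose[OF exp_at_bot]) (simp add: filterlim_uminus_at_bot)
    from tendsto_diff[OF tendsto_const this, of 1]
    show "(\<lambda>n. 1 - exp (- (real n * q n))) \<longlonglongrightarrow> 1" by simp
    show "\<forall>\<^sub>F n in sequentially. 1 - exp (- (real n * q n)) \<le> ?P n"
      using eventually_ge_at_top[of 1] by eventually_elim (rule lower)
  qed simp_all
  then have "(\<lambda>n. ereal (?P n)) \<longlonglongrightarrow> ereal 1" by (intro tendsto_ereal)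
  then have liminf: "liminf (\<lambda>n. ereal (?P n)) = 1"
    using lim_imp_Liminf[of sequentially "\<lambda>n. ereal (?P n)" "ereal 1"] by (simp add: one_ereal_def)
  show ?thesis
  proof (rule exI[of _ M], rule exI[of _ \<eta>], intro conjI)
    show "prob_space M" by (rule M.prob_space_axioms)
    show "\<forall>t\<ge>1. distr M borel (\<eta> t) = distr M borel (\<eta> 1)" by (simp add: law)
    show "\<forall>t\<ge>1. M.expectation (\<eta> t) = 0 \<and> M.variance (\<eta> t) = 1 \<and> psi2_norm M (\<eta> t) < \<infinity>"
      using mean variance psi2 by blast
  qed (use indep tail[unfolded tail_bound_def] scaling liminf fdd in blast)+
qed

end
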